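(* Let $T$ be Tsirelson's space and let $X$ be an infinite dimensional subspace of $T$. Then there exists a sequence $(x_i)\subseteq X$ having a spreading model which is 1-equivalent to the unit vector basis of $\ell_1$.
   Context: Subspaces are closed; scalars are real. For finite sets $E,F\subseteq\mathbb N$, $E<F$ means $\max E<\min F$, and $n\le E$ means $n\le\min E$. For a finitely supported real sequence $x$ and $E\subseteq\mathbb N$, $Ex$ denotes the restriction of $x$ to $E$ (coordinates outside $E$ are replaced by $0$). Tsirelson's space $T$ is the completion of the linear space $c_{00}$ of finitely supported real sequences under the norm given implicitly by $$\|x\|=\max\Big(\|x\|_\infty,\ \sup\Big\{\tfrac12\sum_{i=1}^n\|E_ix\| : n\in\mathbb N,\ n\le E_1<\cdots<E_n\Big\}\Big).$$ Spreading model: let $(x_i)$ be a normalized basic sequence (spreading models are only defined for normalized basic sequences). A basic sequence $(s_i)$ (in some Banach space, whose norm is also denoted $\|\cdot\|$) is a spreading model of $(x_i)$ if for some sequence $\varepsilon_n\downarrow 0$, for all $n$ and all $(a_i)_1^n\in[-1,1]^n$, $$\left|\Big\|\sum_{i=1}^n a_i x_{k_i}\Big\|-\Big\|\sum_{i=1}^n a_i s_i\Big\|\right|<\varepsilon_n\quad\text{whenever } n\le k_1<\cdots<k_n.$$ That $(s_i)$ is 1-equivalent to the unit vector basis of $\ell_1$ means $\|\sum_{i=1}^n a_is_i\|=\sum_{i=1}^n|a_i|$ for all $n$ and all real $(a_i)_1^n$. *)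

theory Defs
  imports "HOL-Analysis.Analysis"
begin

section \<open>The completion of a normed space\<close>

lemma Cauchy_const_seq: "Cauchy (\<lambda>_ :: nat. x :: 'a::metric_space)"
  by (rule LIMSEQ_imp_Cauchy[OF tendsto_const])

lemma Cauchy_add_seq:
  fixes X Y :: "nat \<Rightarrow> 'a::real_normed_vector"
  assumes "Cauchy X" "Cauchy Y"
  shows "Cauchy (\<lambda>n. X n + Y n)"
proof -
  have "bounded_linear (\<lambda>p :: 'a \<times> 'a. fst p + snd p)"
    by (intro bounded_linear_add bounded_linear_fst bounded_linear_snd)
  from bounded_linear.Cauchy[OF this Cauchy_Pair[OF assms]] show ?thesis
    by simp
qed

lemma Cauchy_diff_seq:
  fixes X Y :: "nat \<Rightarrow> 'a::real_normed_vector"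
  assumes "Cauchy X" "Cauchy Y"
  shows "Cauchy (\<lambda>n. X n - Y n)"
proof -
  have "bounded_linear (\<lambda>p :: 'a \<times> 'a. fst p - snd p)"
    by (intro bounded_linear_sub bounded_linear_fst bounded_linear_snd)
  from bounded_linear.Cauchy[OF this Cauchy_Pair[OF assms]] show ?thesis
    by simp
qed

definition cauchy_equiv :: "(nat \<Rightarrow> 'a::real_normed_vector) \<Rightarrow> (nat \<Rightarrow> 'a) \<Rightarrow> bool" where
  "cauchy_equiv X Y \<longleftrightarrow> Cauchy X \<and> Cauchy Y \<and> (\<lambda>n. X n - Y n) \<longlonglongrightarrow> 0"

lemma cauchy_equiv_part_equivp:
  "part_equivp (cauchy_equiv :: (nat \<Rightarrow> 'a::real_normed_vector) \<Rightarrow> _)"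
proof (rule part_equivpI)
  show "\<exists>X. cauchy_equiv X (X :: nat \<Rightarrow> 'a)"
    by (rule exI[of _ "\<lambda>_. 0"]) (simp add: cauchy_equiv_def Cauchy_const_seq)
  show "symp (cauchy_equiv :: (nat \<Rightarrow> 'a) \<Rightarrow> _)"
  proof (rule sympI)
    fix X Y :: "nat \<Rightarrow> 'a"
    assume *: "cauchy_equiv X Y"
    then have "(\<lambda>n. - (X n - Y n)) \<longlonglongrightarrow> - 0"
      unfolding cauchy_equiv_def by (intro tendsto_minus) simp
    with * show "cauchy_equiv Y X"
      by (simp add: cauchy_equiv_def)
  qed
  show "transp (cauchy_equiv :: (nat \<Rightarrow> 'a) \<Rightarrow> _)"
  proof (rule transpI)
    fix X Y Z :: "nat \<Rightarrow> 'a"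
    assume *: "cauchy_equiv X Y" "cauchy_equiv Y Z"
    then have "(\<lambda>n. (X n - Y n) + (Y n - Z n)) \<longlonglongrightarrow> 0 + 0"
      unfolding cauchy_equiv_def by (intro tendsto_add) simp_all
    with * show "cauchy_equiv X Z"
      by (simp add: cauchy_equiv_def)
  qed
qed

quotient_type (overloaded) 'a completion = "nat \<Rightarrow> 'a::real_normed_vector" / partial: cauchy_equiv
  by (rule cauchy_equiv_part_equivp)

lemma Cauchy_scaleR:
  fixes X :: "nat \<Rightarrow> 'a::real_normed_vector"
  assumes "Cauchy X"
  shows "Cauchy (\<lambda>n. c *\<^sub>R X n)"
  using bounded_linear.Cauchy[OF bounded_linear_scaleR_right assms] .

lemma Cauchy_norm':
  fixes X :: "nat \<Rightarrow> 'a::real_normed_vector"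
  assumes "Cauchy X"
  shows "convergent (\<lambda>n. norm (X n))"
proof -
  have "Cauchy (\<lambda>n. norm (X n))"
  proof (rule CauchyI)
    fix e :: real
    assume "e > 0"
    then obtain M where M: "\<And>m n. m \<ge> M \<Longrightarrow> n \<ge> M \<Longrightarrow> norm (X m - X n) < e"
      using CauchyD[OF assms] by blast
    have "norm (norm (X m) - norm (X n)) < e" if "m \<ge> M" "n \<ge> M" for m n
      using M[OF that] norm_triangle_ineq3[of "X m" "X n"] by simp
    then show "\<exists>M. \<forall>m\<ge>M. \<forall>n\<ge>M. norm (norm (X m) - norm (X n)) < e"
      by blast
  qed
  then show ?thesis
    by (rule Cauchy_convergent)
qed

lemma cauchy_equiv_lim_norm:
  assumes "cauchy_equiv X Y"
  shows "lim (\<lambda>n. norm (X n)) = lim (\<lambda>n. norm (Y n))"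
proof -
  have X: "(\<lambda>n. norm (X n)) \<longlonglongrightarrow> lim (\<lambda>n. norm (X n))"
    using assms Cauchy_norm' convergent_LIMSEQ_iff unfolding cauchy_equiv_def by blast
  have Y: "(\<lambda>n. norm (Y n)) \<longlonglongrightarrow> lim (\<lambda>n. norm (Y n))"
    using assms Cauchy_norm' convergent_LIMSEQ_iff unfolding cauchy_equiv_def by blast
  have "(\<lambda>n. norm (X n - Y n)) \<longlonglongrightarrow> 0"
    using assms by (simp add: cauchy_equiv_def tendsto_norm_zero)
  then have "(\<lambda>n. norm (X n) - norm (Y n)) \<longlonglongrightarrow> 0"
    by (rule Lim_null_comparison[rotated]) (simp add: norm_triangle_ineq3)
  moreover have "(\<lambda>n. norm (X n) - norm (Y n)) \<longlonglongrightarrow> lim (\<lambda>n. norm (X n)) - lim (\<lambda>n. norm (Y n))"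
    by (intro tendsto_diff X Y)
  ultimately have "lim (\<lambda>n. norm (X n)) - lim (\<lambda>n. norm (Y n)) = 0"
    using LIMSEQ_unique by blast
  then show ?thesis by simp
qed

instantiation completion :: (real_normed_vector) real_vector
begin

lift_definition zero_completion :: "'a completion" is "\<lambda>_. 0"
  by (simp add: cauchy_equiv_def Cauchy_const_seq)

lift_definition plus_completion :: "'a completion \<Rightarrow> 'a completion \<Rightarrow> 'a completion"
  is "\<lambda>X Y n. X n + Y n"
proof -
  fix X X' Y Y' :: "nat \<Rightarrow> 'a"
  assume *: "cauchy_equiv X X'" "cauchy_equiv Y Y'"
  then have "(\<lambda>n. (X n - X' n) + (Y n - Y' n)) \<longlonglongrightarrow> 0 + 0"
    unfolding cauchy_equiv_def by (intro tendsto_add) simp_all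
  with * show "cauchy_equiv (\<lambda>n. X n + Y n) (\<lambda>n. X' n + Y' n)"
    by (simp add: cauchy_equiv_def Cauchy_add_seq algebra_simps)
qed

lift_definition minus_completion :: "'a completion \<Rightarrow> 'a completion \<Rightarrow> 'a completion"
  is "\<lambda>X Y n. X n - Y n"
proof -
  fix X X' Y Y' :: "nat \<Rightarrow> 'a"
  assume *: "cauchy_equiv X X'" "cauchy_equiv Y Y'"
  then have "(\<lambda>n. (X n - X' n) - (Y n - Y' n)) \<longlonglongrightarrow> 0 - 0"
    unfolding cauchy_equiv_def by (intro tendsto_diff) simp_all
  with * show "cauchy_equiv (\<lambda>n. X n - Y n) (\<lambda>n. X' n - Y' n)"
    by (simp add: cauchy_equiv_def Cauchy_diff_seq algebra_simps)
qed

lift_definition scaleR_completion :: "real \<Rightarrow> 'a completion \<Rightarrow> 'a completion"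
  is "\<lambda>c X n. c *\<^sub>R X n"
proof -
  fix c :: real and X X' :: "nat \<Rightarrow> 'a"
  assume *: "cauchy_equiv X X'"
  then have "(\<lambda>n. c *\<^sub>R (X n - X' n)) \<longlonglongrightarrow> c *\<^sub>R 0"
    unfolding cauchy_equiv_def by (intro tendsto_scaleR tendsto_const) simp_all
  with * show "cauchy_equiv (\<lambda>n. c *\<^sub>R X n) (\<lambda>n. c *\<^sub>R X' n)"
    by (simp add: cauchy_equiv_def Cauchy_scaleR algebra_simps)
qed

lift_definition uminus_completion :: "'a completion \<Rightarrow> 'a completion" is "\<lambda>X n. - X n"
proof -
  fix X X' :: "nat \<Rightarrow> 'a"
  assume *: "cauchy_equiv X X'"
  then have "(\<lambda>n. - (X n - X' n)) \<longlonglongrightarrow> - 0"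
    unfolding cauchy_equiv_def by (intro tendsto_minus) simp
  moreover have "Cauchy (\<lambda>n. - Y n)" if "Cauchy Y" for Y :: "nat \<Rightarrow> 'a"
    using Cauchy_scaleR[OF that, of "- 1"] by simp
  ultimately show "cauchy_equiv (\<lambda>n. - X n) (\<lambda>n. - X' n)"
    using * by (simp add: cauchy_equiv_def)
qed

instance
proof
  fix x y z :: "'a completion" and a b :: real
  show "x + y + z = x + (y + z)"
    by transfer (auto simp: cauchy_equiv_def algebra_simps Cauchy_add_seq)
  show "x + y = y + x"
    by transfer (auto simp: cauchy_equiv_def algebra_simps Cauchy_add_seq)
  show "0 + x = x"
    by transfer (auto simp: cauchy_equiv_def)
  show "- x + x = 0"
    by transfer (auto simp: cauchy_equiv_def Cauchy_const_seq)
  show "x - y = x + - y"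
    by transfer (auto simp: cauchy_equiv_def Cauchy_diff_seq)
  show "a *\<^sub>R (x + y) = a *\<^sub>R x + a *\<^sub>R y"
    by transfer (auto simp: cauchy_equiv_def algebra_simps intro!: Cauchy_add_seq Cauchy_scaleR)
  show "(a + b) *\<^sub>R x = a *\<^sub>R x + b *\<^sub>R x"
    by transfer (auto simp: cauchy_equiv_def algebra_simps intro!: Cauchy_add_seq Cauchy_scaleR)
  show "a *\<^sub>R b *\<^sub>R x = (a * b) *\<^sub>R x"
    by transfer (auto simp: cauchy_equiv_def intro!: Cauchy_scaleR)
  show "1 *\<^sub>R x = x"
    by transfer (auto simp: cauchy_equiv_def)
qed

end

instantiation completion :: (real_normed_vector) real_normed_vector
begin

lift_definition norm_completion :: "'a completion \<Rightarrow> real"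
  is "\<lambda>X. lim (\<lambda>n. norm (X n))"
  by (rule cauchy_equiv_lim_norm)

definition dist_completion :: "'a completion \<Rightarrow> 'a completion \<Rightarrow> real" where
  "dist_completion x y = norm (x - y)"

definition sgn_completion :: "'a completion \<Rightarrow> 'a completion" where
  "sgn_completion x = x /\<^sub>R norm x"

definition uniformity_completion :: "('a completion \<times> 'a completion) filter" where
  "uniformity_completion = (INF e\<in>{0<..}. principal {(x, y). dist x y < e})"

definition open_completion :: "'a completion set \<Rightarrow> bool" where
  "open_completion U \<longleftrightarrow> (\<forall>x\<in>U. \<forall>\<^sub>F (x', y) in uniformity. x' = x \<longrightarrow> y \<in> U)"

instance
proof
  fix x y :: "'a completion" and a :: real
  show "sgn x = x /\<^sub>R norm x"
    by (rule sgn_completion_def)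
  show "dist x y = norm (x - y)"
    by (rule dist_completion_def)
  show "uniformity = (INF e\<in>{0<..}. principal {(x :: 'a completion, y). dist x y < e})"
    by (rule uniformity_completion_def)
  show "open U \<longleftrightarrow> (\<forall>x\<in>U. \<forall>\<^sub>F (x', y) in uniformity. x' = x \<longrightarrow> y \<in> U)"
    for U :: "'a completion set"
    by (rule open_completion_def)
  show "norm x = 0 \<longleftrightarrow> x = 0"
  proof (transfer, safe)
    fix X :: "nat \<Rightarrow> 'a"
    assume X: "cauchy_equiv X X" and 0: "lim (\<lambda>n. norm (X n)) = 0"
    then have "(\<lambda>n. norm (X n)) \<longlonglongrightarrow> 0"
      using Cauchy_norm' convergent_LIMSEQ_iff unfolding cauchy_equiv_def by metis
    then have "X \<longlonglongrightarrow> 0"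
      by (simp add: tendsto_norm_zero_iff)
    with X show "cauchy_equiv X (\<lambda>_. 0)"
      by (simp add: cauchy_equiv_def Cauchy_const_seq)
  next
    fix X :: "nat \<Rightarrow> 'a"
    assume "cauchy_equiv X (\<lambda>_. 0)"
    then show "lim (\<lambda>n. norm (X n)) = 0"
      using cauchy_equiv_lim_norm[of X "\<lambda>_. 0"] by simp
  qed
  show "norm (x + y) \<le> norm x + norm y"
  proof transfer
    fix X Y :: "nat \<Rightarrow> 'a"
    assume "cauchy_equiv X X" "cauchy_equiv Y Y"
    then have C: "Cauchy X" "Cauchy Y" "Cauchy (\<lambda>n. X n + Y n)"
      by (simp_all add: cauchy_equiv_def Cauchy_add_seq)
    have "(\<lambda>n. norm (X n) + norm (Y n)) \<longlonglongrightarrow> lim (\<lambda>n. norm (X n)) + lim (\<lambda>n. norm (Y n))"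
      using C Cauchy_norm' convergent_LIMSEQ_iff by (intro tendsto_add) blast+
    moreover have "(\<lambda>n. norm (X n + Y n)) \<longlonglongrightarrow> lim (\<lambda>n. norm (X n + Y n))"
      using Cauchy_norm'[OF C(3)] convergent_LIMSEQ_iff by blast
    ultimately show "lim (\<lambda>n. norm (X n + Y n)) \<le> lim (\<lambda>n. norm (X n)) + lim (\<lambda>n. norm (Y n))"
      by (intro LIMSEQ_le[of _ _ "\<lambda>n. norm (X n) + norm (Y n)"] exI[of _ 0])
        (auto intro: norm_triangle_ineq)
  qed
  show "norm (a *\<^sub>R x) = \<bar>a\<bar> * norm x"
  proof transfer
    fix a :: real and X :: "nat \<Rightarrow> 'a"
    assume "cauchy_equiv X X"
    then have "(\<lambda>n. norm (X n)) \<longlonglongrightarrow> lim (\<lambda>n. norm (X n))"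
      using Cauchy_norm' convergent_LIMSEQ_iff unfolding cauchy_equiv_def by blast
    then have "(\<lambda>n. norm (a *\<^sub>R X n)) \<longlonglongrightarrow> \<bar>a\<bar> * lim (\<lambda>n. norm (X n))"
      by (simp add: tendsto_mult_left)
    then show "lim (\<lambda>n. norm (a *\<^sub>R X n)) = \<bar>a\<bar> * lim (\<lambda>n. norm (X n))"
      by (rule limI)
  qed
qed

end

lift_definition to_completion :: "'a::real_normed_vector \<Rightarrow> 'a completion" is "\<lambda>x _. x"
  by (simp add: cauchy_equiv_def Cauchy_const_seq)

lemma norm_to_completion [simp]: "norm (to_completion x) = norm x"
  by transfer (simp add: convergent_def)

lemma to_completion_add: "to_completion (x + y) = to_completion x + to_completion y"
  by transfer (simp add: cauchy_equiv_def Cauchy_const_seq)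

lemma to_completion_diff: "to_completion (x - y) = to_completion x - to_completion y"
  by transfer (simp add: cauchy_equiv_def Cauchy_const_seq)

lemma to_completion_scaleR: "to_completion (c *\<^sub>R x) = c *\<^sub>R to_completion x"
  by transfer (simp add: cauchy_equiv_def Cauchy_const_seq)

lemma linear_to_completion: "linear to_completion"
  by (rule linearI) (simp_all add: to_completion_add to_completion_scaleR)

lemma completion_limit:
  fixes x :: "'a::real_normed_vector completion"
  obtains X where "Cauchy X" "(\<lambda>n. to_completion (X n)) \<longlonglongrightarrow> x"
    "x = abs_completion X"
proof -
  obtain X where X: "cauchy_equiv X X" "x = abs_completion X"
    using Quotient_completion by (metis Quotient_rep_reflp Quotient_abs_rep)
  then have C: "Cauchy X"
    by (simp add: cauchy_equiv_def)
  have *: "norm (to_completion u - x) = lim (\<lambda>n. norm (u - X n))" for u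
  proof -
    have "cauchy_equiv (\<lambda>_. u) (\<lambda>_. u)"
      by (simp add: cauchy_equiv_def Cauchy_const_seq)
    moreover have "cauchy_equiv (\<lambda>n. u - X n) (\<lambda>n. u - X n)"
      using C by (simp add: cauchy_equiv_def Cauchy_diff_seq Cauchy_const_seq)
    ultimately show ?thesis
      using X by (simp add: to_completion.abs_eq minus_completion.abs_eq norm_completion.abs_eq)
  qed
  have "(\<lambda>n. to_completion (X n)) \<longlonglongrightarrow> x"
  proof (rule LIMSEQ_I)
    fix r :: real
    assume "r > 0"
    then obtain M where M: "\<And>m n. m \<ge> M \<Longrightarrow> n \<ge> M \<Longrightarrow> norm (X m - X n) < r / 2"
      using CauchyD[OF C, of "r / 2"] by auto
    have "norm (to_completion (X m) - x) < r" if "m \<ge> M" for m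
    proof -
      have "Cauchy (\<lambda>n. X m - X n)"
        using C by (simp add: Cauchy_diff_seq Cauchy_const_seq)
      then have "(\<lambda>n. norm (X m - X n)) \<longlonglongrightarrow> lim (\<lambda>n. norm (X m - X n))"
        using Cauchy_norm' convergent_LIMSEQ_iff by blast
      moreover have "\<exists>N. \<forall>n\<ge>N. norm (X m - X n) \<le> r / 2"
        using M[OF that] less_imp_le by blast
      ultimately have "lim (\<lambda>n. norm (X m - X n)) \<le> r / 2"
        by (rule LIMSEQ_le_const2)
      then show ?thesis
        using \<open>r > 0\<close> by (simp add: *)
    qed
    then show "\<exists>no. \<forall>n\<ge>no. norm (to_completion (X n) - x) < r"
      by blast
  qed
  with C X that show thesis by blast
qed

lemma closure_range_to_completion: "closure (range to_completion) = UNIV"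
proof -
  have "x \<in> closure (range to_completion)" for x :: "'a completion"
  proof -
    obtain X where "(\<lambda>n. to_completion (X n)) \<longlonglongrightarrow> x"
      using completion_limit by metis
    then show ?thesis
      unfolding closure_sequential by (intro exI[of _ "\<lambda>n. to_completion (X n)"]) simp
  qed
  then show ?thesis by blast
qed

instance completion :: (real_normed_vector) banach
proof
  fix Z :: "nat \<Rightarrow> 'a completion"
  assume Z: "Cauchy Z"
  have "\<exists>u. norm (to_completion u - Z n) < inverse (real (Suc n))" for n
  proof -
    obtain X where "(\<lambda>k. to_completion (X k)) \<longlonglongrightarrow> Z n"
      using completion_limit by metis
    then show ?thesis
      using LIMSEQ_D[of _ "Z n" "inverse (real (Suc n))"] by fastforce
  qed
  then obtain u where u: "\<And>n. norm (to_completion (u n) - Z n) < inverse (real (Suc n))"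
    by metis
  have null: "(\<lambda>n. to_completion (u n) - Z n) \<longlonglongrightarrow> 0"
    using LIMSEQ_inverse_real_of_nat by (rule Lim_null_comparison[rotated]) (intro always_eventually allI less_imp_le u)
  then have "Cauchy (\<lambda>n. (to_completion (u n) - Z n) + Z n)"
    by (intro Cauchy_add_seq Z LIMSEQ_imp_Cauchy)
  then have "Cauchy u"
    by (simp add: Cauchy_iff flip: to_completion_diff)
  then have *: "cauchy_equiv u u"
    by (simp add: cauchy_equiv_def)
  have lim: "(\<lambda>n. to_completion (u n)) \<longlonglongrightarrow> abs_completion u"
  proof -
    obtain X where X: "Cauchy X" "(\<lambda>n. to_completion (X n)) \<longlonglongrightarrow> abs_completion u"
      "abs_completion u = abs_completion X"
      using completion_limit by metis
    show ?thesis
    proof (rule LIMSEQ_I)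
      fix r :: real
      assume "r > 0"
      then obtain M where M: "\<And>m n. m \<ge> M \<Longrightarrow> n \<ge> M \<Longrightarrow> norm (u m - u n) < r / 2"
        using CauchyD[OF \<open>Cauchy u\<close>, of "r / 2"] by auto
      have "norm (to_completion (u m) - abs_completion u) < r" if "m \<ge> M" for m
      proof -
        have c: "cauchy_equiv (\<lambda>_. u m) (\<lambda>_. u m)" "Cauchy (\<lambda>n. u m - u n)"
          using \<open>Cauchy u\<close> by (simp_all add: cauchy_equiv_def Cauchy_const_seq Cauchy_diff_seq)
        then have "cauchy_equiv (\<lambda>n. u m - u n) (\<lambda>n. u m - u n)"
          by (simp add: cauchy_equiv_def)
        with c * have "norm (to_completion (u m) - abs_completion u) = lim (\<lambda>n. norm (u m - u n))"
          by (simp add: to_completion.abs_eq minus_completion.abs_eq norm_completion.abs_eq)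
        moreover have "(\<lambda>n. norm (u m - u n)) \<longlonglongrightarrow> lim (\<lambda>n. norm (u m - u n))"
          using c Cauchy_norm' convergent_LIMSEQ_iff by blast
        then have "lim (\<lambda>n. norm (u m - u n)) \<le> r / 2"
          by (rule LIMSEQ_le_const2) (use M[OF that] less_imp_le in blast)
        ultimately show ?thesis
          using \<open>r > 0\<close> by simp
      qed
      then show "\<exists>no. \<forall>n\<ge>no. norm (to_completion (u n) - abs_completion u) < r"
        by blast
    qed
  qed
  have "(\<lambda>n. to_completion (u n) - (to_completion (u n) - Z n)) \<longlonglongrightarrow> abs_completion u - 0"
    by (intro tendsto_diff lim null)
  then show "convergent Z"
    by (auto simp: convergent_def)
qed


section \<open>Finitely supported sequences and Tsirelson's norm\<close>

text \<open>
  Coordinates are indexed by \<open>1, 2, 3, \<dots>\<close>, so that \<open>n \<le> min E\<close> has its usual meaning; the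
  unused coordinate \<open>0\<close> is forced to vanish.
\<close>

typedef c00 = "{x :: nat \<Rightarrow> real. finite {i. x i \<noteq> 0} \<and> x 0 = 0}"
  morphisms coord Abs_c00
  by (rule exI[of _ "\<lambda>_. 0"]) simp

setup_lifting type_definition_c00

lemma finite_support: "finite {i. coord x i \<noteq> 0}"
  and coord_at_0 [simp]: "coord x 0 = 0"
  using coord[of x] by auto

lemma c00_eqI: "(\<And>i. coord x i = coord y i) \<Longrightarrow> x = y"
  by transfer auto

instantiation c00 :: real_vector
begin

lift_definition zero_c00 :: c00 is "\<lambda>_. 0"
  by simp

lift_definition plus_c00 :: "c00 \<Rightarrow> c00 \<Rightarrow> c00" is "\<lambda>x y i. x i + y i"
proof -
  fix x y :: "nat \<Rightarrow> real"
  assume *: "finite {i. x i \<noteq> 0} \<and> x 0 = 0" "finite {i. y i \<noteq> 0} \<and> y 0 = 0"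
  then have "finite ({i. x i \<noteq> 0} \<union> {i. y i \<noteq> 0})"
    by blast
  then have "finite {i. x i + y i \<noteq> 0}"
    by (rule rev_finite_subset) auto
  with * show "finite {i. x i + y i \<noteq> 0} \<and> x 0 + y 0 = 0"
    by simp
qed

lift_definition minus_c00 :: "c00 \<Rightarrow> c00 \<Rightarrow> c00" is "\<lambda>x y i. x i - y i"
proof -
  fix x y :: "nat \<Rightarrow> real"
  assume *: "finite {i. x i \<noteq> 0} \<and> x 0 = 0" "finite {i. y i \<noteq> 0} \<and> y 0 = 0"
  then have "finite ({i. x i \<noteq> 0} \<union> {i. y i \<noteq> 0})"
    by blast
  then have "finite {i. x i - y i \<noteq> 0}"
    by (rule rev_finite_subset) auto
  with * show "finite {i. x i - y i \<noteq> 0} \<and> x 0 - y 0 = 0"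
    by simp
qed

lift_definition uminus_c00 :: "c00 \<Rightarrow> c00" is "\<lambda>x i. - x i"
  by simp

lift_definition scaleR_c00 :: "real \<Rightarrow> c00 \<Rightarrow> c00" is "\<lambda>c x i. c * x i"
  by (auto elim: rev_finite_subset)

instance
  by standard (transfer; auto simp: fun_eq_iff algebra_simps)+

end

lemma coord_zero [simp]: "coord 0 i = 0"
  and coord_add [simp]: "coord (x + y) i = coord x i + coord y i"
  and coord_diff [simp]: "coord (x - y) i = coord x i - coord y i"
  and coord_uminus [simp]: "coord (- x) i = - coord x i"
  and coord_scaleR [simp]: "coord (c *\<^sub>R x) i = c * coord x i"
  by (transfer, simp)+

lift_definition restrict_c00 :: "nat set \<Rightarrow> c00 \<Rightarrow> c00" is "\<lambda>E x i. if i \<in> E then x i else 0"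
  by (auto elim: rev_finite_subset)

lemma coord_restrict [simp]: "coord (restrict_c00 E x) i = (if i \<in> E then coord x i else 0)"
  by transfer simp

definition sup_norm :: "c00 \<Rightarrow> real" where
  "sup_norm x = (SUP i. \<bar>coord x i\<bar>)"

definition admissible :: "nat \<Rightarrow> (nat \<Rightarrow> nat set) \<Rightarrow> bool" where
  "admissible n E \<longleftrightarrow> 1 \<le> n \<and> (\<forall>i\<in>{1..n}. finite (E i) \<and> E i \<noteq> {}) \<and>
     n \<le> Min (E 1) \<and> (\<forall>i\<in>{1..<n}. Max (E i) < Min (E (i + 1)))"

definition tsirelson_sums :: "(c00 \<Rightarrow> real) \<Rightarrow> c00 \<Rightarrow> real set" where
  "tsirelson_sums N x = {1/2 * (\<Sum>i=1..n. N (restrict_c00 (E i) x)) | n E. admissible n E}"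

text \<open>
  The boundedness clause excludes reals for which \<^const>\<open>Sup\<close> is an unspecified value.
\<close>

definition is_tsirelson_norm :: "(c00 \<Rightarrow> real) \<Rightarrow> bool" where
  "is_tsirelson_norm N \<longleftrightarrow>
     (\<forall>x. N x = 0 \<longleftrightarrow> x = 0) \<and>
     (\<forall>x y. N (x + y) \<le> N x + N y) \<and>
     (\<forall>c x. N (c *\<^sub>R x) = \<bar>c\<bar> * N x) \<and>
     (\<forall>x. bdd_above (tsirelson_sums N x) \<and> N x = max (sup_norm x) (Sup (tsirelson_sums N x)))"

definition tsirelson_norm :: "c00 \<Rightarrow> real" where
  "tsirelson_norm = (THE N. is_tsirelson_norm N)"


subsection \<open>The implicit equation has exactly one solution\<close>

lemma sup_norm_bdd: "bdd_above (range (\<lambda>i. \<bar>coord x i\<bar>))"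
proof -
  have "range (\<lambda>i. \<bar>coord x i\<bar>) \<subseteq> insert 0 ((\<lambda>i. \<bar>coord x i\<bar>) ` {i. coord x i \<noteq> 0})"
    by auto
  then have "finite (range (\<lambda>i. \<bar>coord x i\<bar>))"
    by (rule finite_subset) (simp add: finite_support)
  then show ?thesis by (rule bdd_above_finite)
qed

lemma coord_le_sup_norm: "\<bar>coord x i\<bar> \<le> sup_norm x"
  unfolding sup_norm_def by (rule cSUP_upper[OF _ sup_norm_bdd]) simp

lemma sup_norm_leI: "(\<And>i. \<bar>coord x i\<bar> \<le> b) \<Longrightarrow> sup_norm x \<le> b"
  unfolding sup_norm_def by (rule cSUP_least) auto

lemma sup_norm_nonneg: "0 \<le> sup_norm x"
  using coord_le_sup_norm[of x 0] by simp

lemma sup_norm_eq_0: "sup_norm x = 0 \<Longrightarrow> x = 0"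
  using coord_le_sup_norm[of x] by (intro c00_eqI) simp

lemma sup_norm_zero: "sup_norm 0 = 0"
  by (intro antisym sup_norm_leI sup_norm_nonneg) simp

lemma sup_norm_add: "sup_norm (x + y) \<le> sup_norm x + sup_norm y"
proof (rule sup_norm_leI)
  fix i
  show "\<bar>coord (x + y) i\<bar> \<le> sup_norm x + sup_norm y"
    using coord_le_sup_norm[of x i] coord_le_sup_norm[of y i] by simp
qed

lemma sup_norm_scaleR_le: "sup_norm (c *\<^sub>R x) \<le> \<bar>c\<bar> * sup_norm x"
  by (rule sup_norm_leI) (simp add: abs_mult mult_left_mono coord_le_sup_norm)

lemma admissible_less:
  assumes "admissible n E" "1 \<le> i" "i < j" "j \<le> n" "a \<in> E i" "b \<in> E j"
  shows "a < b"
proof -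
  have *: "finite (E k)" "E k \<noteq> {}" if "1 \<le> k" "k \<le> n" for k
    using assms(1) that by (auto simp: admissible_def)
  have step: "a < b" if "1 \<le> k" "k < n" "a \<in> E k" "b \<in> E (Suc k)" for k a b
  proof -
    have "a \<le> Max (E k)" "Min (E (Suc k)) \<le> b"
      using that * by auto
    moreover have "Max (E k) < Min (E (Suc k))"
      using assms(1) that by (auto simp: admissible_def)
    ultimately show ?thesis by linarith
  qed
  have "\<forall>b \<in> E (i + Suc d). i + Suc d \<le> n \<longrightarrow> a < b" for d
  proof (induction d)
    case 0
    then show ?case
      using step[of i] assms by auto
  next
    case (Suc d)
    show ?case
    proof (intro ballI impI)
      fix b
      assume b: "b \<in> E (i + Suc (Suc d))" "i + Suc (Suc d) \<le> n"
      then obtain c where c: "c \<in> E (i + Suc d)"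
        using *[of "i + Suc d"] by auto
      then have "a < c"
        using Suc b by auto
      also have "c < b"
        using step[of "i + Suc d" c b] c b by simp
      finally show "a < b" .
    qed
  qed
  from this[of "j - i - 1"] show ?thesis
    using assms by auto
qed

lemma admissible_disjoint:
  assumes "admissible n E" "i \<in> {1..n}" "j \<in> {1..n}" "i \<noteq> j"
  shows "E i \<inter> E j = {}"
  using assms admissible_less[OF assms(1)] by (cases i j rule: linorder_cases) fastforce+

lemma admissible_singleton: "admissible 1 (\<lambda>_. {1})"
  by (simp add: admissible_def)

lemma tsirelson_sums_nonempty: "tsirelson_sums N x \<noteq> {}"
  unfolding tsirelson_sums_def using admissible_singleton by blast

definition ell1_norm :: "c00 \<Rightarrow> real" where
  "ell1_norm x = (\<Sum>i | coord x i \<noteq> 0. \<bar>coord x i\<bar>)"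

lemma ell1_norm_eq:
  assumes "finite A" "{i. coord x i \<noteq> 0} \<subseteq> A"
  shows "ell1_norm x = (\<Sum>i\<in>A. \<bar>coord x i\<bar>)"
  unfolding ell1_norm_def using assms by (intro sum.mono_neutral_left) auto

lemma ell1_norm_nonneg: "0 \<le> ell1_norm x"
  by (simp add: ell1_norm_def sum_nonneg)

lemma sup_norm_le_ell1_norm: "sup_norm x \<le> ell1_norm x"
proof (rule sup_norm_leI)
  fix i
  have "\<bar>coord x i\<bar> \<le> ell1_norm x" if "coord x i \<noteq> 0"
    unfolding ell1_norm_def using that finite_support
    by (intro member_le_sum[of i _ "\<lambda>i. \<bar>coord x i\<bar>"]) auto
  then show "\<bar>coord x i\<bar> \<le> ell1_norm x"
    using ell1_norm_nonneg by (cases "coord x i = 0") auto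
qed

lemma sum_ell1_norm_le:
  assumes "admissible n E"
  shows "(\<Sum>i=1..n. ell1_norm (restrict_c00 (E i) x)) \<le> ell1_norm x"
proof -
  define A where "A = {j. coord x j \<noteq> 0}"
  have A: "finite A"
    by (simp add: A_def finite_support)
  have "ell1_norm (restrict_c00 (E i) x) = (\<Sum>j\<in>E i \<inter> A. \<bar>coord x j\<bar>)" for i
  proof -
    have "ell1_norm (restrict_c00 (E i) x) = (\<Sum>j\<in>E i \<inter> A. \<bar>coord (restrict_c00 (E i) x) j\<bar>)"
      using A by (intro ell1_norm_eq) (auto simp: A_def)
    then show ?thesis by simp
  qed
  then have "(\<Sum>i=1..n. ell1_norm (restrict_c00 (E i) x)) = (\<Sum>i=1..n. \<Sum>j\<in>E i \<inter> A. \<bar>coord x j\<bar>)"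
    by simp
  also have "\<dots> = (\<Sum>j\<in>(\<Union>i\<in>{1..n}. E i \<inter> A). \<bar>coord x j\<bar>)"
    using A admissible_disjoint[OF assms] by (intro sum.UNION_disjoint[symmetric]) blast+
  also have "\<dots> \<le> (\<Sum>j\<in>A. \<bar>coord x j\<bar>)"
    using A by (intro sum_mono2) auto
  finally show ?thesis
    by (simp add: ell1_norm_def A_def)
qed

lemma restrict_c00_add: "restrict_c00 E (x + y) = restrict_c00 E x + restrict_c00 E y"
  and restrict_c00_scaleR: "restrict_c00 E (c *\<^sub>R x) = c *\<^sub>R restrict_c00 E x"
  by (auto intro!: c00_eqI)

lemma tsirelson_sums_bound:
  assumes "\<And>y. N y \<le> ell1_norm y" "a \<in> tsirelson_sums N x"
  shows "a \<le> ell1_norm x"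
proof -
  obtain n E where a: "a = 1/2 * (\<Sum>i=1..n. N (restrict_c00 (E i) x))" and E: "admissible n E"
    using assms(2) by (auto simp: tsirelson_sums_def)
  have "(\<Sum>i=1..n. N (restrict_c00 (E i) x)) \<le> (\<Sum>i=1..n. ell1_norm (restrict_c00 (E i) x))"
    by (intro sum_mono assms(1))
  also have "\<dots> \<le> ell1_norm x"
    by (rule sum_ell1_norm_le[OF E])
  finally show ?thesis
    using a ell1_norm_nonneg[of x] by simp
qed

lemma tsirelson_sums_bdd:
  assumes "\<And>y. N y \<le> ell1_norm y"
  shows "bdd_above (tsirelson_sums N x)"
  using tsirelson_sums_bound[OF assms] by (rule bdd_aboveI)

lemma tsirelson_sums_upper:
  assumes "bdd_above (tsirelson_sums N x)" "admissible n E"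
  shows "1/2 * (\<Sum>i=1..n. N (restrict_c00 (E i) x)) \<le> Sup (tsirelson_sums N x)"
  using assms by (intro cSup_upper) (auto simp: tsirelson_sums_def)

lemma tsirelson_sums_least:
  assumes "\<And>n E. admissible n E \<Longrightarrow> 1/2 * (\<Sum>i=1..n. N (restrict_c00 (E i) x)) \<le> b"
  shows "Sup (tsirelson_sums N x) \<le> b"
proof (rule cSup_least[OF tsirelson_sums_nonempty])
  fix a
  assume "a \<in> tsirelson_sums N x"
  then show "a \<le> b"
    unfolding tsirelson_sums_def using assms by blast
qed

primrec tsirelson_iter :: "nat \<Rightarrow> c00 \<Rightarrow> real" where
  "tsirelson_iter 0 x = sup_norm x"
| "tsirelson_iter (Suc m) x = max (sup_norm x) (Sup (tsirelson_sums (tsirelson_iter m) x))"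

lemma tsirelson_iter_le_ell1_norm: "tsirelson_iter m x \<le> ell1_norm x"
proof (induction m arbitrary: x)
  case 0
  then show ?case by (simp add: sup_norm_le_ell1_norm)
next
  case (Suc m)
  have "Sup (tsirelson_sums (tsirelson_iter m) x) \<le> ell1_norm x"
    by (rule cSup_least[OF tsirelson_sums_nonempty]) (rule tsirelson_sums_bound[OF Suc.IH])
  then show ?case
    by (simp add: sup_norm_le_ell1_norm)
qed

lemma tsirelson_iter_bdd: "bdd_above (tsirelson_sums (tsirelson_iter m) x)"
  by (rule tsirelson_sums_bdd[OF tsirelson_iter_le_ell1_norm])

lemma sup_norm_le_tsirelson_iter: "sup_norm x \<le> tsirelson_iter m x"
  by (cases m) auto

lemma tsirelson_iter_Suc_ge: "tsirelson_iter m x \<le> tsirelson_iter (Suc m) x"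
proof (induction m arbitrary: x)
  case 0
  then show ?case by simp
next
  case (Suc m)
  have "Sup (tsirelson_sums (tsirelson_iter m) x) \<le> Sup (tsirelson_sums (tsirelson_iter (Suc m)) x)"
  proof (rule tsirelson_sums_least)
    fix n E
    assume E: "admissible n E"
    have "(\<Sum>i=1..n. tsirelson_iter m (restrict_c00 (E i) x))
        \<le> (\<Sum>i=1..n. tsirelson_iter (Suc m) (restrict_c00 (E i) x))"
      by (intro sum_mono Suc.IH)
    then show "1/2 * (\<Sum>i=1..n. tsirelson_iter m (restrict_c00 (E i) x))
        \<le> Sup (tsirelson_sums (tsirelson_iter (Suc m)) x)"
      using tsirelson_sums_upper[OF tsirelson_iter_bdd[of "Suc m" x] E] by linarith
  qed
  then show ?case
    unfolding tsirelson_iter.simps(2)[of m x] tsirelson_iter.simps(2)[of "Suc m" x]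
    by (intro max.mono order_refl)
qed

lemma tsirelson_iter_add: "tsirelson_iter m (x + y) \<le> tsirelson_iter m x + tsirelson_iter m y"
proof (induction m arbitrary: x y)
  case 0
  then show ?case by (simp add: sup_norm_add)
next
  case (Suc m)
  have "Sup (tsirelson_sums (tsirelson_iter m) (x + y))
      \<le> Sup (tsirelson_sums (tsirelson_iter m) x) + Sup (tsirelson_sums (tsirelson_iter m) y)"
  proof (rule tsirelson_sums_least)
    fix n E
    assume E: "admissible n E"
    have "(\<Sum>i=1..n. tsirelson_iter m (restrict_c00 (E i) (x + y)))
        \<le> (\<Sum>i=1..n. tsirelson_iter m (restrict_c00 (E i) x) + tsirelson_iter m (restrict_c00 (E i) y))"
      by (intro sum_mono) (simp add: restrict_c00_add Suc.IH)
    then show "1/2 * (\<Sum>i=1..n. tsirelson_iter m (restrict_c00 (E i) (x + y)))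
        \<le> Sup (tsirelson_sums (tsirelson_iter m) x) + Sup (tsirelson_sums (tsirelson_iter m) y)"
      using tsirelson_sums_upper[OF tsirelson_iter_bdd[of m x] E]
        tsirelson_sums_upper[OF tsirelson_iter_bdd[of m y] E]
      by (simp add: sum.distrib)
  qed
  then show ?case
    using sup_norm_add[of x y] unfolding tsirelson_iter.simps by linarith
qed

lemma tsirelson_iter_scaleR_le: "tsirelson_iter m (c *\<^sub>R x) \<le> \<bar>c\<bar> * tsirelson_iter m x"
proof (induction m arbitrary: x)
  case 0
  then show ?case by (simp add: sup_norm_scaleR_le)
next
  case (Suc m)
  have "Sup (tsirelson_sums (tsirelson_iter m) (c *\<^sub>R x))
      \<le> \<bar>c\<bar> * Sup (tsirelson_sums (tsirelson_iter m) x)"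
  proof (rule tsirelson_sums_least)
    fix n E
    assume E: "admissible n E"
    have "(\<Sum>i=1..n. tsirelson_iter m (restrict_c00 (E i) (c *\<^sub>R x)))
        \<le> (\<Sum>i=1..n. \<bar>c\<bar> * tsirelson_iter m (restrict_c00 (E i) x))"
      by (intro sum_mono) (simp add: restrict_c00_scaleR Suc.IH)
    also have "\<dots> = \<bar>c\<bar> * (\<Sum>i=1..n. tsirelson_iter m (restrict_c00 (E i) x))"
      by (simp add: sum_distrib_left)
    finally show "1/2 * (\<Sum>i=1..n. tsirelson_iter m (restrict_c00 (E i) (c *\<^sub>R x)))
        \<le> \<bar>c\<bar> * Sup (tsirelson_sums (tsirelson_iter m) x)"
      using mult_left_mono[OF tsirelson_sums_upper[OF tsirelson_iter_bdd[of m x] E], of "\<bar>c\<bar>"]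
      by simp
  qed
  then show ?case
    using sup_norm_scaleR_le[of c x] unfolding tsirelson_iter.simps
    by (simp add: max_mult_distrib_left max.coboundedI1 max.coboundedI2)
qed

lemma ell1_norm_zero: "ell1_norm 0 = 0"
  by (simp add: ell1_norm_def)

lemma is_tsirelson_norm_exists: "\<exists>N. is_tsirelson_norm N"
proof
  define N where "N x = (SUP m. tsirelson_iter m x)" for x
  have bdd: "bdd_above (range (\<lambda>m. tsirelson_iter m x))" for x
    by (rule bdd_aboveI2) (rule tsirelson_iter_le_ell1_norm)
  have up: "tsirelson_iter m x \<le> N x" for m x
    unfolding N_def by (rule cSUP_upper[OF _ bdd]) simp
  have least: "N x \<le> b" if "\<And>m. tsirelson_iter m x \<le> b" for x b
    unfolding N_def using that by (intro cSUP_least) auto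
  have lim: "(\<lambda>m. tsirelson_iter m x) \<longlonglongrightarrow> N x" for x
    unfolding N_def by (rule LIMSEQ_incseq_SUP[OF bdd]) (intro incseq_SucI tsirelson_iter_Suc_ge)
  have ell1: "N x \<le> ell1_norm x" for x
    by (intro least tsirelson_iter_le_ell1_norm)
  have sup: "sup_norm x \<le> N x" for x
    using up[of 0 x] by simp
  have scale_le: "N (c *\<^sub>R x) \<le> \<bar>c\<bar> * N x" for c x
  proof (rule least)
    fix m
    have "\<bar>c\<bar> * tsirelson_iter m x \<le> \<bar>c\<bar> * N x"
      by (intro mult_left_mono up) simp
    then show "tsirelson_iter m (c *\<^sub>R x) \<le> \<bar>c\<bar> * N x"
      using tsirelson_iter_scaleR_le[of m c x] by linarith
  qed
  have N0: "N 0 = 0"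
    using ell1[of 0] sup[of 0] sup_norm_nonneg[of 0] by (simp add: ell1_norm_zero)
  show "is_tsirelson_norm N"
    unfolding is_tsirelson_norm_def
  proof (intro conjI allI)
    fix x y :: c00 and c :: real
    show "N x = 0 \<longleftrightarrow> x = 0"
      using sup[of x] sup_norm_nonneg[of x] sup_norm_eq_0[of x] N0 by auto
    show "N (x + y) \<le> N x + N y"
    proof (rule least)
      fix m
      show "tsirelson_iter m (x + y) \<le> N x + N y"
        using tsirelson_iter_add[of m x y] up[of m x] up[of m y] by linarith
    qed
    show "N (c *\<^sub>R x) = \<bar>c\<bar> * N x"
    proof (cases "c = 0")
      case False
      have "\<bar>c\<bar> * N x = \<bar>c\<bar> * N (inverse c *\<^sub>R (c *\<^sub>R x))"
        using False by simp
      also have "\<dots> \<le> \<bar>c\<bar> * (\<bar>inverse c\<bar> * N (c *\<^sub>R x))"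
        by (intro mult_left_mono scale_le) simp
      also have "\<dots> = N (c *\<^sub>R x)"
        using False by (simp add: field_simps abs_inverse)
      finally show ?thesis
        using scale_le[of c x] by linarith
    qed (simp add: N0)
    show bddS: "bdd_above (tsirelson_sums N x)"
      by (rule tsirelson_sums_bdd[OF ell1])
    show "N x = max (sup_norm x) (Sup (tsirelson_sums N x))"
    proof (rule antisym)
      show "N x \<le> max (sup_norm x) (Sup (tsirelson_sums N x))"
      proof (rule least)
        fix m
        show "tsirelson_iter m x \<le> max (sup_norm x) (Sup (tsirelson_sums N x))"
        proof (cases m)
          case (Suc k)
          have "Sup (tsirelson_sums (tsirelson_iter k) x) \<le> Sup (tsirelson_sums N x)"
          proof (rule tsirelson_sums_least)
            fix n E
            assume E: "admissible n E"
            have "(\<Sum>i=1..n. tsirelson_iter k (restrict_c00 (E i) x)) \<le> (\<Sum>i=1..n. N (restrict_c00 (E i) x))"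
              by (intro sum_mono up)
            then show "1/2 * (\<Sum>i=1..n. tsirelson_iter k (restrict_c00 (E i) x)) \<le> Sup (tsirelson_sums N x)"
              using tsirelson_sums_upper[OF bddS E] by linarith
          qed
          then show ?thesis
            using Suc by auto
        qed simp
      qed
      have "Sup (tsirelson_sums N x) \<le> N x"
      proof (rule tsirelson_sums_least)
        fix n E
        assume E: "admissible n E"
        have "(\<lambda>m. 1/2 * (\<Sum>i=1..n. tsirelson_iter m (restrict_c00 (E i) x)))
            \<longlonglongrightarrow> 1/2 * (\<Sum>i=1..n. N (restrict_c00 (E i) x))"
          by (intro tendsto_mult tendsto_const tendsto_sum lim)
        moreover have "1/2 * (\<Sum>i=1..n. tsirelson_iter m (restrict_c00 (E i) x)) \<le> N x" for m
          using tsirelson_sums_upper[OF tsirelson_iter_bdd[of m x] E] up[of "Suc m" x] by simp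
        ultimately show "1/2 * (\<Sum>i=1..n. N (restrict_c00 (E i) x)) \<le> N x"
          by (intro LIMSEQ_le_const2) auto
      qed
      then show "max (sup_norm x) (Sup (tsirelson_sums N x)) \<le> N x"
        using sup by simp
    qed
  qed
qed

lemma is_tsirelson_norm_le:
  assumes "is_tsirelson_norm N" "is_tsirelson_norm M"
    and eq: "\<And>y. card {i. coord y i \<noteq> 0} < card {i. coord x i \<noteq> 0} \<Longrightarrow> N y = M y"
  shows "N x \<le> M x"
proof -
  let ?A = "{i. coord x i \<noteq> 0}"
  have N: "N 0 = 0" "bdd_above (tsirelson_sums N x)" "N x = max (sup_norm x) (Sup (tsirelson_sums N x))"
    and M: "bdd_above (tsirelson_sums M x)" "M x = max (sup_norm x) (Sup (tsirelson_sums M x))"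
    using assms(1,2) by (auto simp: is_tsirelson_norm_def)
  have M_nonneg: "0 \<le> M x"
    using M sup_norm_nonneg[of x] by linarith
  have "Sup (tsirelson_sums N x) \<le> max (M x) (N x / 2)"
  proof (rule tsirelson_sums_least)
    fix n E
    assume E: "admissible n E"
    show "1/2 * (\<Sum>i=1..n. N (restrict_c00 (E i) x)) \<le> max (M x) (N x / 2)"
    proof (cases "\<exists>i\<in>{1..n}. ?A \<subseteq> E i")
      case True
      then obtain i where i: "i \<in> {1..n}" "?A \<subseteq> E i"
        by blast
      have "restrict_c00 (E i) x = x"
        using i by (intro c00_eqI) auto
      moreover have "restrict_c00 (E j) x = 0" if "j \<in> {1..n} - {i}" for j
        using i that admissible_disjoint[OF E, of i j] by (intro c00_eqI) auto
      ultimately have "(\<Sum>j=1..n. N (restrict_c00 (E j) x)) = N x"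
        using i N(1) by (simp add: sum.remove[of _ i])
      then show ?thesis by simp
    next
      case False
      have "N (restrict_c00 (E i) x) = M (restrict_c00 (E i) x)" if "i \<in> {1..n}" for i
      proof (intro eq psubset_card_mono finite_support)
        show "{j. coord (restrict_c00 (E i) x) j \<noteq> 0} \<subset> ?A"
          using False that by auto
      qed
      then have "1/2 * (\<Sum>i=1..n. N (restrict_c00 (E i) x)) = 1/2 * (\<Sum>i=1..n. M (restrict_c00 (E i) x))"
        by simp
      also have "\<dots> \<le> M x"
        using tsirelson_sums_upper[OF M(1) E] M(2) by linarith
      finally show ?thesis by linarith
    qed
  qed
  moreover have "sup_norm x \<le> M x"
    using M(2) by linarith
  ultimately have "N x \<le> max (M x) (N x / 2)"
    using N(3) by linarith
  then show ?thesis
    using M_nonneg by linarith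
qed

theorem is_tsirelson_norm_ex1: "\<exists>!N. is_tsirelson_norm N"
proof (rule ex_ex1I[OF is_tsirelson_norm_exists])
  fix N M
  assume *: "is_tsirelson_norm N" "is_tsirelson_norm M"
  have "N x = M x" for x
  proof (induction "card {i. coord x i \<noteq> 0}" arbitrary: x rule: less_induct)
    case less
    then show ?case
      using is_tsirelson_norm_le[OF *, of x] is_tsirelson_norm_le[OF *(2,1), of x] by fastforce
  qed
  then show "N = M" by blast
qed

lemma is_tsirelson_norm_tsirelson_norm: "is_tsirelson_norm tsirelson_norm"
  unfolding tsirelson_norm_def by (rule theI'[OF is_tsirelson_norm_ex1])


section \<open>Tsirelson's space\<close>

instantiation c00 :: real_normed_vector
begin

definition norm_c00 :: "c00 \<Rightarrow> real" where
  "norm_c00 = tsirelson_norm"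

definition dist_c00 :: "c00 \<Rightarrow> c00 \<Rightarrow> real" where
  "dist_c00 x y = norm (x - y)"

definition sgn_c00 :: "c00 \<Rightarrow> c00" where
  "sgn_c00 x = x /\<^sub>R norm x"

definition uniformity_c00 :: "(c00 \<times> c00) filter" where
  "uniformity_c00 = (INF e\<in>{0<..}. principal {(x, y). dist x y < e})"

definition open_c00 :: "c00 set \<Rightarrow> bool" where
  "open_c00 U \<longleftrightarrow> (\<forall>x\<in>U. \<forall>\<^sub>F (x', y) in uniformity. x' = x \<longrightarrow> y \<in> U)"

instance
proof
  fix x y :: c00 and a :: real
  show "sgn x = x /\<^sub>R norm x"
    by (rule sgn_c00_def)
  show "dist x y = norm (x - y)"
    by (rule dist_c00_def)
  show "uniformity = (INF e\<in>{0<..}. principal {(x :: c00, y). dist x y < e})"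
    by (rule uniformity_c00_def)
  show "open U \<longleftrightarrow> (\<forall>x\<in>U. \<forall>\<^sub>F (x', y) in uniformity. x' = x \<longrightarrow> y \<in> U)" for U :: "c00 set"
    by (rule open_c00_def)
  show "norm x = 0 \<longleftrightarrow> x = 0" "norm (x + y) \<le> norm x + norm y" "norm (a *\<^sub>R x) = \<bar>a\<bar> * norm x"
    using is_tsirelson_norm_tsirelson_norm unfolding is_tsirelson_norm_def norm_c00_def by blast+
qed

end

type_synonym tsirelson = "c00 completion"


section \<open>Spreading models\<close>

text \<open>
  Sequences of vectors are indexed from \<open>0\<close>: the term \<open>x i\<close> stands for
  the \<open>(i+1)\<close>-st term of the sequence. This accounts for the successor in
  \<open>n \<le> Suc (k 0)\<close> below.
\<close>

definition basic_sequence :: "(nat \<Rightarrow> 'a::banach) \<Rightarrow> bool" where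
  "basic_sequence x \<longleftrightarrow>
     (\<forall>v \<in> closure (span (range x)). \<exists>!a :: nat \<Rightarrow> real. (\<lambda>i. a i *\<^sub>R x i) sums v)"

definition normalized :: "(nat \<Rightarrow> 'a::real_normed_vector) \<Rightarrow> bool" where
  "normalized x \<longleftrightarrow> (\<forall>i. norm (x i) = 1)"

definition spreading_model :: "(nat \<Rightarrow> 'a::banach) \<Rightarrow> (nat \<Rightarrow> 'b::banach) \<Rightarrow> bool" where
  "spreading_model x s \<longleftrightarrow>
     normalized x \<and> basic_sequence x \<and> basic_sequence s \<and>
     (\<exists>\<epsilon> :: nat \<Rightarrow> real. decseq \<epsilon> \<and> \<epsilon> \<longlonglongrightarrow> 0 \<and>
       (\<forall>n \<ge> 1. \<forall>a :: nat \<Rightarrow> real. \<forall>k :: nat \<Rightarrow> nat.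
          (\<forall>i<n. a i \<in> {-1..1}) \<longrightarrow> strict_mono_on {..<n} k \<longrightarrow> n \<le> Suc (k 0) \<longrightarrow>
          \<bar>norm (\<Sum>i<n. a i *\<^sub>R x (k i)) - norm (\<Sum>i<n. a i *\<^sub>R s i)\<bar> < \<epsilon> n))"

definition isometric_to_ell1_basis :: "(nat \<Rightarrow> 'a::real_normed_vector) \<Rightarrow> bool" where
  "isometric_to_ell1_basis s \<longleftrightarrow>
     (\<forall>n. \<forall>a :: nat \<Rightarrow> real. norm (\<Sum>i<n. a i *\<^sub>R s i) = (\<Sum>i<n. \<bar>a i\<bar>))"

instance bcontfun :: (topological_space, complete_space) complete_space
proof
  fix f :: "nat \<Rightarrow> ('a, 'b) bcontfun"
  assume "Cauchy f"
  then obtain g where "uniform_limit UNIV f g sequentially"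
    using uniformly_convergent_eq_cauchy[of "\<lambda>_. True" f]
    unfolding Cauchy_def uniform_limit_sequentially_iff
    by (metis dist_fun_lt_imp_dist_val_lt)
  from uniform_limit_bcontfunE[OF this sequentially_bot]
  obtain l where "f \<longlonglongrightarrow> l" by metis
  then show "convergent f"
    by (intro convergentI)
qed

instance bcontfun :: (topological_space, banach) banach ..

text \<open>
  Bounded continuous functions on the discrete space \<open>nat\<close>. Every separable Banach space, in
  particular the closed span of any basic sequence, embeds isometrically into this one, so that
  a basic sequence in some Banach space may always be taken here.
\<close>

type_synonym ell_infinity = "nat \<Rightarrow>\<^sub>C real"

end

theory Submission
  imports Defs "HOL-Real_Asymp.Real_Asymp"
begin

text \<open>
  The norm of a sum of \<open>n\<close> normalized blocks that start far out is at least half the sum of the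
  norms of \<open>r\<close> successive pieces of it, as long as \<open>r\<close> does not exceed the starting point. So the
  \<open>\<ell>\<^sub>1\<close>-norm of the coefficients is attained up to \<open>\<epsilon>\<close> if each block splits into a number of
  pieces, bounded in terms of \<open>\<epsilon>\<close> alone, whose norms add up to almost \<open>2\<close>. The proof builds
  blocks for which \<open>p\<close> pieces reach \<open>2 (1 - 2\<^sup>-\<^sup>p)\<close>, up to a factor tending to \<open>1\<close>, for every \<open>p\<close>
  up to the index of the block.

  Such a block is a normalization of \<open>w\<^sub>0 + 2 w\<^sub>1 + \<dots> + 2\<^sup>m\<^sup>-\<^sup>1 w\<^sub>m\<^sub>-\<^sub>1\<close>, where the \<open>w\<^sub>l\<close> are successive
  normalized vectors and \<open>w\<^sub>l\<close> is flat: it is a very long average, so that few sets, namely no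
  more than the point where \<open>w\<^sub>l\<close> starts, catch pieces of total norm at most \<open>1 + \<delta>\<close>. An
  admissible family whose first hit is \<open>w\<^sub>k\<close> has at most as many members as the end of \<open>w\<^sub>k\<close>.
  Half the sum of its pieces is therefore at most \<open>2\<^sup>k\<close> on \<open>w\<^sub>k\<close> and at most \<open>(1 + \<delta>) 2\<^sup>l\<^sup>-\<^sup>1\<close> on each
  later \<open>w\<^sub>l\<close>, and the total is at most \<open>(1 + \<delta>) 2\<^sup>m\<^sup>-\<^sup>1\<close> whatever \<open>k\<close> is
  (\<open>norm_growing_flat_sum_le\<close>). On the other hand the top \<open>p\<close> summands alone have norms adding up
  to \<open>2\<^sup>m - 2\<^sup>m\<^sup>-\<^sup>p\<close>, which after normalization is the estimate above (\<open>top_heavy_vector_exists\<close>).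

  Flat vectors come from the classical blocking argument for \<open>\<ell>\<^sub>1\<close>: if no \<open>N\<close> successive vectors
  of norm at most \<open>C > 1\<close> had an average of norm one, then sums of \<open>N\<^sup>k\<close> normalized blocks would
  have norm at most \<open>(N/C)\<^sup>k\<close>, which contradicts the lower bound \<open>N\<^sup>k/2\<close> once \<open>C\<^sup>k > 2\<close>
  (\<open>ell1_average_exists\<close>).

  All this takes place inside a subspace of finitely supported vectors which has nonzero vectors
  arbitrarily far out. An infinite dimensional subspace \<open>X\<close> of the completion is brought into
  this situation by a gliding hump: finitely many coordinate functionals have a common nonzero
  zero in \<open>X\<close>, so \<open>X\<close> is approximated by the span of a block sequence, and the approximation
  improves along the sequence (\<open>deep_subspace_exists\<close>). The blocks are finally replaced by unit
  vectors of \<open>X\<close> close to them, which changes neither the spreading model nor the fact that the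
  sequence is basic.
\<close>

section \<open>The norm of finitely supported vectors\<close>

definition supp :: "c00 \<Rightarrow> nat set" where
  "supp x = {i. coord x i \<noteq> 0}"

lemma finite_supp: "finite (supp x)"
  unfolding supp_def by (rule finite_support)

lemma restrict_eq_self: "supp x \<subseteq> A \<Longrightarrow> restrict_c00 A x = x"
  by (rule c00_eqI) (auto simp: supp_def)

lemma restrict_eq_zero: "A \<inter> supp x = {} \<Longrightarrow> restrict_c00 A x = 0"
  by (rule c00_eqI) (auto simp: supp_def)

lemma restrict_sum: "restrict_c00 A (\<Sum>i\<in>I. f i) = (\<Sum>i\<in>I. restrict_c00 A (f i))"
proof (induction I rule: infinite_finite_induct)
  case (insert i I)
  then show ?case by (simp add: restrict_c00_add)
qed (simp_all add: restrict_eq_zero supp_def)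

lemma supp_scaleR: "supp (c *\<^sub>R x) = (if c = 0 then {} else supp x)"
  by (auto simp: supp_def)

lemma supp_sum: "supp (\<Sum>i\<in>I. f i) \<subseteq> (\<Union>i\<in>I. supp (f i))"
proof (induction I rule: infinite_finite_induct)
  case (insert i I)
  have "supp (f i + (\<Sum>i\<in>I. f i)) \<subseteq> supp (f i) \<union> supp (\<Sum>i\<in>I. f i)"
    by (auto simp: supp_def)
  with insert show ?case by auto
qed (simp_all add: supp_def)

lemma norm_c00_implicit:
  fixes x :: c00
  shows "norm x = max (sup_norm x) (Sup (tsirelson_sums norm x))"
    and "bdd_above (tsirelson_sums norm x)"
proof -
  have *: "bdd_above (tsirelson_sums tsirelson_norm x) \<and>
      tsirelson_norm x = max (sup_norm x) (Sup (tsirelson_sums tsirelson_norm x))"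
    using is_tsirelson_norm_tsirelson_norm unfolding is_tsirelson_norm_def
    by (elim conjE) (erule spec)
  show "norm x = max (sup_norm x) (Sup (tsirelson_sums norm x))"
    and "bdd_above (tsirelson_sums norm x)"
    unfolding norm_c00_def by (rule conjunct2[OF *])  (rule conjunct1[OF *])
qed

lemma coord_le_norm: "\<bar>coord x i\<bar> \<le> norm x"
  using coord_le_sup_norm[of x i] norm_c00_implicit(1)[of x] by linarith

lemma admissible_sum_le:
  "admissible n E \<Longrightarrow> (\<Sum>i=1..n. norm (restrict_c00 (E i) x)) \<le> 2 * norm x"
  using tsirelson_sums_upper[OF norm_c00_implicit(2), of n E x] norm_c00_implicit(1)[of x] by linarith

lemma norm_c00_leI:
  assumes "\<And>i. \<bar>coord x i\<bar> \<le> b"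
    and "\<And>n E. admissible n E \<Longrightarrow> (\<Sum>i=1..n. norm (restrict_c00 (E i) x)) \<le> 2 * b"
  shows "norm x \<le> b"
proof -
  have "Sup (tsirelson_sums norm x) \<le> b"
    by (rule tsirelson_sums_least) (use assms(2) in fastforce)
  moreover have "sup_norm x \<le> b"
    using assms(1) by (rule sup_norm_leI)
  ultimately show ?thesis
    unfolding norm_c00_implicit(1)[of x] by simp
qed

text \<open>
  The implicit equation expresses the norm of \<open>x\<close> through pieces of \<open>x\<close>. A piece is either a proper
  one, which the induction on the size of the support handles, or all of \<open>x\<close>; in the latter case
  it is the only nonzero piece, and the factor \<open>1/2\<close> makes the resulting estimate harmless.
\<close>

lemma norm_c00_mono:
  assumes "\<And>i. \<bar>coord x i\<bar> \<le> \<bar>coord y i\<bar>"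
  shows "norm x \<le> norm y"
  using assms
proof (induction "card (supp x)" arbitrary: x y rule: less_induct)
  case less
  have "norm x \<le> max (norm y) (norm x / 2)"
  proof (rule norm_c00_leI)
    fix i
    show "\<bar>coord x i\<bar> \<le> max (norm y) (norm x / 2)"
      using less.prems[of i] coord_le_norm[of y i] by linarith
  next
    fix n E
    assume E: "admissible n E"
    show "(\<Sum>i=1..n. norm (restrict_c00 (E i) x)) \<le> 2 * max (norm y) (norm x / 2)"
    proof (cases "\<exists>i\<in>{1..n}. supp x \<subseteq> E i")
      case True
      then obtain i where i: "i \<in> {1..n}" "supp x \<subseteq> E i"
        by blast
      have "restrict_c00 (E j) x = 0" if "j \<in> {1..n} - {i}" for j
        using i that admissible_disjoint[OF E, of i j] by (intro restrict_eq_zero) auto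
      then have "(\<Sum>j=1..n. norm (restrict_c00 (E j) x)) = norm x"
        using i by (simp add: sum.remove[of _ i] restrict_eq_self)
      then show ?thesis by simp
    next
      case False
      have "norm (restrict_c00 (E i) x) \<le> norm (restrict_c00 (E i) y)" if "i \<in> {1..n}" for i
      proof (rule less.hyps)
        have "supp (restrict_c00 (E i) x) \<subset> supp x"
          using False that by (auto simp: supp_def)
        then show "card (supp (restrict_c00 (E i) x)) < card (supp x)"
          by (intro psubset_card_mono finite_supp)
      qed (use less.prems in simp)
      then have "(\<Sum>i=1..n. norm (restrict_c00 (E i) x)) \<le> (\<Sum>i=1..n. norm (restrict_c00 (E i) y))"
        by (rule sum_mono)
      also have "\<dots> \<le> 2 * norm y"
        by (rule admissible_sum_le[OF E])
      finally show ?thesis by linarith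
    qed
  qed
  then show ?case
    using norm_ge_zero[of y] by linarith
qed

lemma norm_restrict_le: "norm (restrict_c00 A x) \<le> norm x"
  by (rule norm_c00_mono) simp

text \<open>
  The lower estimate of the norm in a form suited to applications: the successive sets may be
  indexed by any finite set, in any order, and may be empty or infinite. Cutting them down to the
  support of \<open>x\<close>, dropping the empty ones and sorting by minima gives an admissible family.
\<close>

lemma successive_sum_le:
  fixes F :: "'i \<Rightarrow> nat set"
  assumes I: "finite I"
    and succ: "\<And>i j. i \<in> I \<Longrightarrow> j \<in> I \<Longrightarrow> i \<noteq> j \<Longrightarrow>
      (\<forall>a\<in>F i. \<forall>b\<in>F j. a < b) \<or> (\<forall>a\<in>F i. \<forall>b\<in>F j. b < a)"
    and far: "\<And>i. i \<in> I \<Longrightarrow> F i \<subseteq> {card I..}"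
  shows "(\<Sum>i\<in>I. norm (restrict_c00 (F i) x)) \<le> 2 * norm x"
proof -
  define G where "G i = F i \<inter> supp x" for i
  define J where "J = {i\<in>I. G i \<noteq> {}}"
  have FG: "restrict_c00 (F i) x = restrict_c00 (G i) x" for i
    by (rule c00_eqI) (auto simp: G_def supp_def)
  have "(\<Sum>i\<in>I. norm (restrict_c00 (F i) x)) = (\<Sum>i\<in>J. norm (restrict_c00 (G i) x))"
    unfolding FG using I by (intro sum.mono_neutral_right) (auto simp: J_def restrict_eq_zero)
  also have "\<dots> \<le> 2 * norm x"
  proof (cases "J = {}")
    case False
    define M where "M = (\<lambda>i. Min (G i)) ` J"
    have fin: "finite J" "\<And>i. finite (G i)" and ne: "\<And>i. i \<in> J \<Longrightarrow> G i \<noteq> {}"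
      using I finite_supp by (auto simp: J_def G_def)
    then have Min_in: "Min (G i) \<in> G i" if "i \<in> J" for i
      using that by simp
    have ord: "\<forall>a\<in>G i. \<forall>b\<in>G j. a < b" if "i \<in> J" "j \<in> J" "Min (G i) < Min (G j)" for i j
      using succ[of i j] Min_in[of i] Min_in[of j] that by (fastforce simp: J_def G_def)
    have inj: "inj_on (\<lambda>i. Min (G i)) J"
    proof (rule inj_onI)
      fix i j assume ij: "i \<in> J" "j \<in> J" "Min (G i) = Min (G j)"
      then have "Min (G i) \<in> F i" "Min (G i) \<in> F j"
        using Min_in by (fastforce simp: G_def)+
      then show "i = j"
        using succ[of i j] ij by (fastforce simp: J_def)
    qed
    have "finite M" using fin by (simp add: M_def)
    obtain h where h: "bij_betw h {..<card M} M" "strict_mono_on {..<card M} h"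
      using ex_bij_betw_strict_mono_card[OF \<open>finite M\<close>] .
    have cM: "card M = card J"
      unfolding M_def by (rule card_image[OF inj])
    have b: "bij_betw (\<lambda>i. Min (G i)) J M"
      using inj by (simp add: bij_betw_def M_def)
    define g where "g k = the_inv_into J (\<lambda>i. Min (G i)) (h k)" for k
    have g: "bij_betw g {..<card J} J"
      unfolding g_def using bij_betw_trans[OF h(1) bij_betw_the_inv_into[OF b]] cM by (simp add: comp_def)
    have gJ: "g k \<in> J" if "k < card J" for k
      using g that by (auto simp: bij_betw_def)
    have gh: "Min (G (g k)) = h k" if "k < card J" for k
      unfolding g_def using that h(1) cM by (intro f_the_inv_into_f[OF inj]) (auto simp: bij_betw_def M_def)
    have cpos: "0 < card J" using False fin by (simp add: card_gt_0_iff)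
    have "admissible (card J) (\<lambda>k. G (g (k - 1)))"
      unfolding admissible_def
    proof (intro conjI ballI)
      fix k assume k: "k \<in> {1..card J}"
      then have "k - 1 < card J" by auto
      then show "finite (G (g (k - 1)))" "G (g (k - 1)) \<noteq> {}"
        using fin ne[OF gJ] by auto
    next
      have "Min (G (g 0)) \<in> F (g 0)" "g 0 \<in> I"
        using Min_in[of "g 0"] gJ[OF cpos] by (auto simp: J_def G_def)
      moreover have "card J \<le> card I"
        using I by (auto simp: J_def intro: card_mono)
      ultimately show "card J \<le> Min (G (g (1 - 1)))"
        using far[of "g 0"] by auto
    next
      fix k assume k: "k \<in> {1..<card J}"
      then have k': "k - 1 < card J" "k < card J" by auto
      have "h (k - 1) < h k"
        using h(2) k cM by (auto simp: strict_mono_on_def)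
      then have "\<forall>a\<in>G (g (k - 1)). \<forall>b\<in>G (g k). a < b"
        using k' by (intro ord gJ) (simp_all add: gh)
      then show "Max (G (g (k - 1))) < Min (G (g (k + 1 - 1)))"
        using fin ne[OF gJ[OF k'(1)]] ne[OF gJ[OF k'(2)]] by auto
    qed (use cpos in auto)
    from admissible_sum_le[OF this, of x]
    show ?thesis
      using sum.reindex_bij_betw[OF g, of "\<lambda>i. norm (restrict_c00 (G i) x)"]
      by (simp add: sum.atLeast1_atMost_eq)
  qed simp
  finally show ?thesis .
qed


section \<open>Block sequences\<close>

text \<open>
  Successive blocks are chosen one at a time. The property to be achieved may depend on the
  number \<open>t i\<close> beyond which the \<open>i\<close>-th block has to lie, that is, on how far the earlier blocks
  reach.
\<close>

lemma block_selection:
  assumes "\<And>i n. \<exists>x. Q i n x \<and> supp x \<subseteq> {n..}"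
  obtains t :: "nat \<Rightarrow> nat" and x :: "nat \<Rightarrow> c00"
  where "strict_mono t" "t 0 = n" "\<And>i. Q i (t i) (x i)" "\<And>i. supp (x i) \<subseteq> {t i..<t (Suc i)}"
proof -
  define P where "P i p \<longleftrightarrow> Q i (fst p) (snd p) \<and> supp (snd p) \<subseteq> {fst p..} \<and> (i = 0 \<longrightarrow> fst p = n)"
    for i and p :: "nat \<times> c00"
  define R where "R i p p' \<longleftrightarrow> fst p < fst p' \<and> supp (snd p) \<subseteq> {..<fst p'}"
    for i :: nat and p p' :: "nat \<times> c00"
  have "\<exists>f. \<forall>i. P i (f i) \<and> R i (f i) (f (Suc i))"
  proof (rule dependent_nat_choice)
    show "\<exists>p. P 0 p"
      using assms[of 0 n] by (auto simp: P_def)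
    fix p i
    define m where "m = Suc (Max (insert (fst p) (supp (snd p))))"
    have "supp (snd p) \<subseteq> {..<m}" "fst p < m"
      using finite_supp[of "snd p"] by (auto simp: m_def less_Suc_eq_le)
    then show "\<exists>p'. P (Suc i) p' \<and> R i p p'"
      using assms[of "Suc i" m] by (auto simp: P_def R_def)
  qed
  then obtain f where f: "\<And>i. P i (f i)" "\<And>i. R i (f i) (f (Suc i))"
    by blast
  show thesis
  proof (rule that[of "\<lambda>i. fst (f i)" "\<lambda>i. snd (f i)"])
    show "strict_mono (\<lambda>i. fst (f i))"
      using f(2) by (simp add: strict_mono_Suc_iff R_def)
    show "fst (f 0) = n"
      using f(1)[of 0] by (simp add: P_def)
    show "Q i (fst (f i)) (snd (f i))" for i
      using f(1)[of i] by (simp add: P_def)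
    show "supp (snd (f i)) \<subseteq> {fst (f i)..<fst (f (Suc i))}" for i
      using f(1)[of i] f(2)[of i] by (auto simp: P_def R_def)
  qed
qed

lemma strict_mono_blocks_less:
  fixes t :: "nat \<Rightarrow> nat"
  assumes "strict_mono t" "A \<subseteq> {t i..<t (Suc i)}" "B \<subseteq> {t j..<t (Suc j)}" "i < j" "a \<in> A" "b \<in> B"
  shows "a < b"
proof -
  have "t (Suc i) \<le> t j"
    using assms(1,4) by (simp add: strict_mono_less_eq)
  then show ?thesis using assms by force
qed

lemma restrict_block_sum:
  fixes t :: "nat \<Rightarrow> nat" and c :: "nat \<Rightarrow> real"
  assumes t: "strict_mono t" and w: "\<And>l. supp (w l) \<subseteq> {t l..<t (Suc l)}"
  shows "restrict_c00 (supp (w i)) (\<Sum>j<n. c j *\<^sub>R w j) = (if i < n then c i *\<^sub>R w i else 0)"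
proof -
  have "supp (w i) \<inter> supp (w j) = {}" if "j \<noteq> i" for j
    using strict_mono_blocks_less[OF t w w, of i j] strict_mono_blocks_less[OF t w w, of j i] that
    by (metis disjoint_iff less_irrefl linorder_neqE_nat)
  then have "restrict_c00 (supp (w i)) (w j) = (if j = i then w i else 0)" for j
    by (simp add: restrict_eq_self restrict_eq_zero)
  then have "restrict_c00 (supp (w i)) (\<Sum>j<n. c j *\<^sub>R w j) = (\<Sum>j<n. if j = i then c i *\<^sub>R w i else 0)"
    unfolding restrict_sum by (intro sum.cong) (auto simp: restrict_c00_scaleR)
  then show ?thesis by simp
qed

definition block_sequence :: "(nat \<Rightarrow> nat) \<Rightarrow> (nat \<Rightarrow> c00) \<Rightarrow> bool" where
  "block_sequence t u \<longleftrightarrow> strict_mono t \<and> (\<forall>i. norm (u i) = 1 \<and> supp (u i) \<subseteq> {t i..<t (Suc i)})"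

lemma block_coefficient_le:
  assumes u: "block_sequence t u" and i: "i < n"
  shows "\<bar>c i\<bar> \<le> norm (\<Sum>j<n. c j *\<^sub>R u j)"
proof -
  have "\<bar>c i\<bar> = norm (restrict_c00 (supp (u i)) (\<Sum>j<n. c j *\<^sub>R u j))"
    using u i by (subst restrict_block_sum[where t = t]) (auto simp: block_sequence_def)
  then show ?thesis using norm_restrict_le by simp
qed


section \<open>Long averages\<close>

text \<open>
  A set \<open>E\<^sub>j\<close> can only catch a nonzero piece of \<open>x\<^sub>i\<close> if it meets the support, so it suffices to
  count the pairs \<open>(i, j)\<close> that meet. Both families being successive, such pairs form a staircase:
  on it \<open>i + j\<close> determines the pair, and there are fewer than \<open>N + q\<close> possible values.
\<close>

lemma average_split:
  fixes x :: "nat \<Rightarrow> c00"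
  assumes succ: "\<And>i j a b. i < j \<Longrightarrow> j < N \<Longrightarrow> a \<in> supp (x i) \<Longrightarrow> b \<in> supp (x j) \<Longrightarrow> a < b"
    and C: "\<And>i. i < N \<Longrightarrow> norm (x i) \<le> C" "0 \<le> C"
    and E: "\<And>i j a b. 1 \<le> i \<Longrightarrow> i < j \<Longrightarrow> j \<le> q \<Longrightarrow> a \<in> E i \<Longrightarrow> b \<in> E j \<Longrightarrow> a < b"
  shows "(\<Sum>j=1..q. norm (restrict_c00 (E j) (\<Sum>i<N. x i))) \<le> C * real (N + q)"
proof -
  define R where "R = {(i, j). i < N \<and> j \<in> {1..q} \<and> E j \<inter> supp (x i) \<noteq> {}}"
  have R: "R \<subseteq> {..<N} \<times> {1..q}" by (auto simp: R_def)
  then have finR: "finite R" by (rule finite_subset) simp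
  have "inj_on (\<lambda>(i, j). i + j) R"
  proof (rule inj_onI, clarify)
    fix i j i' j'
    assume ij: "(i, j) \<in> R" "(i', j') \<in> R" "i + j = i' + j'"
    then obtain a b where ab: "a \<in> E j" "a \<in> supp (x i)" "b \<in> E j'" "b \<in> supp (x i')"
      by (auto simp: R_def)
    have "\<not> i < i'"
      using succ[of i i' a b] E[of j' j b a] ab ij by (auto simp: R_def)
    moreover have "\<not> i' < i"
      using succ[of i' i b a] E[of j j' a b] ab ij by (auto simp: R_def)
    ultimately show "i = i' \<and> j = j'"
      using ij by auto
  qed
  then have "card R \<le> card {..<N + q}"
    by (rule card_inj_on_le) (auto simp: R_def)
  then have cardR: "card R \<le> N + q" by simp
  have "(\<Sum>j=1..q. norm (restrict_c00 (E j) (\<Sum>i<N. x i)))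
      \<le> (\<Sum>j=1..q. \<Sum>i<N. norm (restrict_c00 (E j) (x i)))"
    by (intro sum_mono) (simp add: restrict_sum norm_sum)
  also have "\<dots> = (\<Sum>i<N. \<Sum>j=1..q. norm (restrict_c00 (E j) (x i)))"
    by (rule sum.swap)
  also have "\<dots> = (\<Sum>(i, j)\<in>{..<N} \<times> {1..q}. norm (restrict_c00 (E j) (x i)))"
    by (rule sum.cartesian_product)
  also have "\<dots> = (\<Sum>(i, j)\<in>R. norm (restrict_c00 (E j) (x i)))"
    using R by (intro sum.mono_neutral_right) (auto simp: R_def restrict_eq_zero)
  also have "\<dots> \<le> (\<Sum>p\<in>R. C)"
    using C(1) by (intro sum_mono) (auto simp: R_def intro: order_trans[OF norm_restrict_le])
  also have "\<dots> \<le> C * real (N + q)"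
    using cardR C(2) by (simp add: mult.commute mult_left_mono del: of_nat_add)
  finally show ?thesis .
qed

text \<open>
  The subspaces of finitely supported vectors in which block sequences can be found.
\<close>

definition deep :: "c00 set \<Rightarrow> bool" where
  "deep V \<longleftrightarrow> subspace V \<and> (\<forall>n. \<exists>z\<in>V. z \<noteq> 0 \<and> supp z \<subseteq> {n..})"

lemma deep_unit_vector:
  assumes "deep V"
  shows "\<exists>z. (z \<in> V \<and> norm z = 1) \<and> supp z \<subseteq> {n..}"
proof -
  obtain z where z: "z \<in> V" "z \<noteq> 0" "supp z \<subseteq> {n..}"
    using assms unfolding deep_def by blast
  have "(1 / norm z) *\<^sub>R z \<in> V"
    using assms z by (auto simp: deep_def intro: subspace_scale)
  then show ?thesis
    using z by (intro exI[of _ "(1 / norm z) *\<^sub>R z"]) (simp add: supp_scaleR)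
qed

text \<open>
  Take \<open>N\<^sup>k\<close> normalized blocks starting beyond \<open>N\<^sup>k\<close>, and sum them in groups of \<open>N\<close>, these sums
  again in groups of \<open>N\<close>, and so on. Whenever all sums of one level have norm at most \<open>r\<close> but some
  sum of the next level has norm more than \<open>r N / C\<close>, then that sum, suitably scaled, is what is
  looked for. Otherwise each level loses a factor \<open>C\<close>, and for \<open>C\<^sup>k > 2\<close> the total sum violates
  the lower estimate \<open>N\<^sup>k / 2\<close>.
\<close>

lemma ell1_average_exists:
  assumes V: "deep V" and C: "1 < C" and N: "1 \<le> N"
  obtains x where "\<And>i. i < N \<Longrightarrow> x i \<in> V" "\<And>i. i < N \<Longrightarrow> norm (x i) \<le> C"
    "\<And>i. i < N \<Longrightarrow> supp (x i) \<subseteq> {n..}"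
    "\<And>i j a b. i < j \<Longrightarrow> j < N \<Longrightarrow> a \<in> supp (x i) \<Longrightarrow> b \<in> supp (x j) \<Longrightarrow> a < b"
    "norm (\<Sum>i<N. x i) = real N"
proof (rule ccontr)
  assume neg: "\<not> thesis"
  obtain k where k: "2 < C ^ k"
    using real_arch_pow[OF C] by blast
  obtain t u where t: "strict_mono t" "t 0 = max n (N ^ k)"
    and u: "\<And>i. u i \<in> V \<and> norm (u i) = 1" "\<And>i. supp (u i) \<subseteq> {t i..<t (Suc i)}"
    by (rule block_selection[where Q = "\<lambda>_ _ z. z \<in> V \<and> norm z = 1" and n = "max n (N ^ k)",
        OF deep_unit_vector[OF V]]) (rule that)
  have t0: "max n (N ^ k) \<le> t i" for i
    using t by (metis strict_mono_less_eq le0)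
  have uu: "a < b" if "i < j" "a \<in> supp (u i)" "b \<in> supp (u j)" for i j a b
    using strict_mono_blocks_less[OF t(1) u(2) u(2)] that by blast
  define S where "S j a = (\<Sum>i<N ^ j. u (a * N ^ j + i))" for j a
  have S_Suc: "S (Suc j) a = (\<Sum>b<N. S j (a * N + b))" for j a
  proof -
    have "S (Suc j) a = (\<Sum>b<N. \<Sum>i\<in>{b * N ^ j..<b * N ^ j + N ^ j}. u (a * N ^ Suc j + i))"
      unfolding S_def sum.nat_group by simp
    also have "\<dots> = (\<Sum>b<N. \<Sum>i<N ^ j. u (a * N ^ Suc j + (b * N ^ j + i)))"
    proof (rule sum.cong)
      fix b
      show "(\<Sum>i\<in>{b * N ^ j..<b * N ^ j + N ^ j}. u (a * N ^ Suc j + i))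
          = (\<Sum>i<N ^ j. u (a * N ^ Suc j + (b * N ^ j + i)))"
        using sum.shift_bounds_nat_ivl[of "\<lambda>i. u (a * N ^ Suc j + i)" 0 "b * N ^ j" "N ^ j"]
        by (simp add: atLeast0LessThan add.commute)
    qed simp
    finally show ?thesis
      by (simp add: S_def algebra_simps)
  qed
  have S_V: "S j a \<in> V" for j a
    using V u(1) by (auto simp: S_def deep_def intro: subspace_sum)
  have S_supp: "\<exists>i. a * N ^ j \<le> i \<and> i < Suc a * N ^ j \<and> c \<in> supp (u i)" if c: "c \<in> supp (S j a)" for j a c
  proof -
    obtain i where "i < N ^ j" "c \<in> supp (u (a * N ^ j + i))"
      using c supp_sum[of "\<lambda>i. u (a * N ^ j + i)" "{..<N ^ j}"] unfolding S_def by blast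
    then show ?thesis by (intro exI[of _ "a * N ^ j + i"]) simp
  qed
  have S_succ: "c < d" if ab: "a < b" and cd: "c \<in> supp (S j a)" "d \<in> supp (S j b)" for j a b c d
  proof -
    obtain i i' where i: "i < Suc a * N ^ j" "c \<in> supp (u i)" "b * N ^ j \<le> i'" "d \<in> supp (u i')"
      using S_supp[OF cd(1)] S_supp[OF cd(2)] by blast
    have "Suc a * N ^ j \<le> b * N ^ j"
      using ab by (intro mult_le_mono1) simp
    then show ?thesis using i uu[of i i' c d] by linarith
  qed
  have S_deep: "supp (S j a) \<subseteq> {n..}" for j a
  proof
    fix c assume "c \<in> supp (S j a)"
    then obtain i where "c \<in> supp (u i)" using S_supp by blast
    then show "c \<in> {n..}" using u(2)[of i] t0[of i] by auto
  qed
  have bound: "norm (S j a) \<le> (N / C) ^ j" for j a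
  proof (induction j arbitrary: a)
    case 0
    then show ?case using u(1) by (simp add: S_def)
  next
    case (Suc j)
    show ?case
    proof (rule ccontr)
      assume *: "\<not> norm (S (Suc j) a) \<le> (N / C) ^ Suc j"
      define s where "s = norm (S (Suc j) a)"
      have "0 < (N / C) ^ Suc j" using N C by simp
      then have s: "0 < s" "(N / C) ^ Suc j < s" using * by (auto simp: s_def)
      have thesis
      proof (rule that[of "\<lambda>b. (N / s) *\<^sub>R S j (a * N + b)"])
        fix b assume "b < N"
        show "(N / s) *\<^sub>R S j (a * N + b) \<in> V"
          using V S_V by (auto simp: deep_def intro: subspace_scale)
        show "supp ((N / s) *\<^sub>R S j (a * N + b)) \<subseteq> {n..}"
          using S_deep by (auto simp: supp_scaleR)
        have "norm ((N / s) *\<^sub>R S j (a * N + b)) \<le> (N / s) * (N / C) ^ j"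
          using s Suc.IH[of "a * N + b"] by (simp add: mult_left_mono divide_right_mono)
        also have "\<dots> = C * (N / C) ^ Suc j / s"
          using C by simp
        also have "\<dots> \<le> C * s / s"
          using s C by (intro divide_right_mono mult_left_mono) auto
        also have "\<dots> = C" using s by simp
        finally show "norm ((N / s) *\<^sub>R S j (a * N + b)) \<le> C" .
      next
        fix b b' c d
        assume "b < b'" "b' < N" "c \<in> supp ((N / s) *\<^sub>R S j (a * N + b))"
          "d \<in> supp ((N / s) *\<^sub>R S j (a * N + b'))"
        then show "c < d"
          using S_succ[of "a * N + b" "a * N + b'" c j d] by (auto simp: supp_scaleR split: if_splits)
      next
        have "(\<Sum>b<N. (N / s) *\<^sub>R S j (a * N + b)) = (N / s) *\<^sub>R S (Suc j) a"
          by (simp add: S_Suc scaleR_right.sum)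
        then show "norm (\<Sum>b<N. (N / s) *\<^sub>R S j (a * N + b)) = real N"
          using s by (simp add: s_def)
      qed
      then show False using neg by blast
    qed
  qed
  have "real (N ^ k) = (\<Sum>i<N ^ k. norm (restrict_c00 (supp (u i)) (\<Sum>l<N ^ k. u l)))"
  proof -
    have "restrict_c00 (supp (u i)) (\<Sum>l<N ^ k. u l) = u i" if "i < N ^ k" for i
      using restrict_block_sum[OF t(1) u(2), of i "\<lambda>_. 1" "N ^ k"] that by simp
    then show ?thesis using u(1) by simp
  qed
  also have "\<dots> \<le> 2 * norm (\<Sum>l<N ^ k. u l)"
  proof (rule successive_sum_le)
    fix i j :: nat assume "i \<noteq> j"
    then show "(\<forall>a\<in>supp (u i). \<forall>b\<in>supp (u j). a < b) \<or> (\<forall>a\<in>supp (u i). \<forall>b\<in>supp (u j). b < a)"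
      using uu[of i j] uu[of j i] by (cases i j rule: linorder_cases) blast+
  next
    fix i
    show "supp (u i) \<subseteq> {card {..<N ^ k}..}"
      using u(2)[of i] t0[of i] by auto
  qed simp
  also have "\<dots> \<le> 2 * (N / C) ^ k"
    using bound[of k 0] by (simp add: S_def)
  finally have "real N ^ k * C ^ k \<le> 2 * real N ^ k"
    using C by (simp add: power_divide field_simps)
  then show False
    using k N by (simp add: mult_le_cancel_left_pos mult.commute)
qed

text \<open>
  No \<open>q\<close> successive sets do much better on \<open>w\<close> than a single one. In contrast to an
  admissible family, the sets may lie anywhere, and some of them may be empty.
\<close>

definition flat :: "nat \<Rightarrow> real \<Rightarrow> c00 \<Rightarrow> bool" where
  "flat q d w \<longleftrightarrow> (\<forall>E. (\<forall>i j a b. 1 \<le> i \<longrightarrow> i < j \<longrightarrow> j \<le> q \<longrightarrow> a \<in> E i \<longrightarrow> b \<in> E j \<longrightarrow> a < b) \<longrightarrow>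
     (\<Sum>i=1..q. norm (restrict_c00 (E i) w)) \<le> 1 + d)"

text \<open>
  An average of \<open>N\<close> vectors, with \<open>N\<close> much larger than \<open>n\<close>, is flat by \<open>average_split\<close>.
\<close>

lemma flat_vector_exists:
  assumes V: "deep V" and d: "0 < d"
  shows "\<exists>w. (w \<in> V \<and> norm w = 1 \<and> (\<forall>q\<le>n. flat q d w)) \<and> supp w \<subseteq> {n..}"
proof -
  \<comment> \<open>Both the constant of the average and the quotient \<open>n / N\<close> cost a factor \<open>1 + e\<close>, and \<open>(1 + e)\<^sup>2 \<le> 1 + 3 e\<close>.\<close>
  define e where "e = min d 1 / 3"
  have e: "0 < e" "3 * e \<le> d" "e \<le> 1" using d by (auto simp: e_def)
  obtain N0 :: nat where N0: "real n / e \<le> real N0"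
    using real_arch_simple by blast
  define N where "N = Suc N0"
  have N: "1 \<le> N" "real n \<le> e * real N"
    using N0 e by (auto simp: N_def field_simps)
  obtain x where x: "\<And>i. i < N \<Longrightarrow> x i \<in> V" "\<And>i. i < N \<Longrightarrow> norm (x i) \<le> 1 + e"
    "\<And>i. i < N \<Longrightarrow> supp (x i) \<subseteq> {n..}"
    "\<And>i j a b. i < j \<Longrightarrow> j < N \<Longrightarrow> a \<in> supp (x i) \<Longrightarrow> b \<in> supp (x j) \<Longrightarrow> a < b"
    "norm (\<Sum>i<N. x i) = real N"
    using ell1_average_exists[OF V, of "1 + e" N n] e N by auto
  define w where "w = (1 / real N) *\<^sub>R (\<Sum>i<N. x i)"
  have "w \<in> V"
    unfolding w_def using V x(1) by (auto simp: deep_def intro!: subspace_scale subspace_sum)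
  moreover have "norm w = 1"
    using x(5) N by (simp add: w_def)
  moreover have "supp w \<subseteq> {n..}"
  proof -
    have "supp w \<subseteq> (\<Union>i<N. supp (x i))"
      using supp_sum[of x "{..<N}"] by (auto simp: w_def supp_scaleR)
    then show ?thesis using x(3) by blast
  qed
  moreover have "flat q d w" if q: "q \<le> n" for q
    unfolding flat_def
  proof (intro allI impI)
    fix E :: "nat \<Rightarrow> nat set"
    assume E: "\<forall>i j a b. 1 \<le> i \<longrightarrow> i < j \<longrightarrow> j \<le> q \<longrightarrow> a \<in> E i \<longrightarrow> b \<in> E j \<longrightarrow> a < b"
    then have E': "\<And>i j a b. 1 \<le> i \<Longrightarrow> i < j \<Longrightarrow> j \<le> q \<Longrightarrow> a \<in> E i \<Longrightarrow> b \<in> E j \<Longrightarrow> a < b"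
      by simp
    have "(\<Sum>i=1..q. norm (restrict_c00 (E i) w)) = (\<Sum>i=1..q. norm (restrict_c00 (E i) (\<Sum>i<N. x i))) / N"
      by (simp add: w_def restrict_c00_scaleR sum_divide_distrib)
    also have "\<dots> \<le> (1 + e) * real (N + q) / N"
    proof (rule divide_right_mono)
      show "(\<Sum>i=1..q. norm (restrict_c00 (E i) (\<Sum>i<N. x i))) \<le> (1 + e) * real (N + q)"
        using average_split[of N x "1 + e" q E, OF x(4) x(2) _ E'] e by simp
    qed simp
    also have "\<dots> \<le> (1 + e) * (real N + e * real N) / N"
      using N q e by (intro divide_right_mono mult_left_mono) auto
    also have "\<dots> = (1 + e) * (1 + e)"
      using N by (simp add: field_simps)
    also have "\<dots> \<le> 1 + d"
    proof -
      have "e * e \<le> e" using e by (simp add: mult_left_le)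
      then show ?thesis unfolding distrib_left distrib_right using e by linarith
    qed
    finally show "(\<Sum>i=1..q. norm (restrict_c00 (E i) w)) \<le> 1 + d" .
  qed
  ultimately show ?thesis by blast
qed


section \<open>Top-heavy vectors\<close>

text \<open>
  The weights \<open>0\<close>, \<open>2\<close> and \<open>1 + d\<close> bound the total norm of the pieces that an admissible family
  catches of the \<open>l\<close>-th summand, where \<open>k\<close> is the first summand that is hit. The excess
  \<open>2\<^sup>k\<close> of the weight \<open>2\<close> over \<open>1\<close> is made up by the summands missed before \<open>k\<close>, which amount to
  \<open>2\<^sup>k - 1\<close>, and by the gap between \<open>2\<^sup>m\<close> and the full sum \<open>2\<^sup>m - 1\<close>.
\<close>

lemma geometric_step_sum_le:
  fixes d :: real
  assumes "0 \<le> d"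
  shows "(\<Sum>l<m. 2 ^ l * (if l < k then 0 else if l = k then 2 else 1 + d)) \<le> (1 + d) * 2 ^ m"
proof (induction m)
  case (Suc m)
  consider "m < k" | "m = k" | "k < m" by linarith
  then show ?case
  proof cases
    case 1
    then show ?thesis using Suc assms by (simp add: algebra_simps)
  next
    case 2
    then show ?thesis using assms by (simp add: algebra_simps)
  next
    case 3
    then show ?thesis using Suc assms by (simp add: algebra_simps)
  qed
qed (use assms in simp)

text \<open>
  If \<open>w k\<close> is the first summand hit by an admissible family, the family has at most \<open>t (Suc k)\<close>
  members, so every later summand is flat for it. What it gains on \<open>w k\<close> it loses by missing all
  the earlier summands.
\<close>

lemma norm_growing_flat_sum_le:
  assumes t: "strict_mono t" and w: "\<And>l. norm (w l) = 1" "\<And>l. supp (w l) \<subseteq> {t l..<t (Suc l)}"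
    and fl: "\<And>l q. q \<le> t l \<Longrightarrow> flat q d (w l)" and d: "0 \<le> d"
  shows "norm (\<Sum>l<m. (2::real) ^ l *\<^sub>R w l) \<le> (1 + d) * 2 ^ m / 2"
proof (rule norm_c00_leI)
  let ?y = "\<Sum>l<m. (2::real) ^ l *\<^sub>R w l"
  fix c
  show "\<bar>coord ?y c\<bar> \<le> (1 + d) * 2 ^ m / 2"
  proof (cases "c \<in> supp ?y")
    case True
    then obtain l where l: "l < m" "c \<in> supp (w l)"
      using supp_sum[of "\<lambda>l. (2::real) ^ l *\<^sub>R w l" "{..<m}"] by (auto simp: supp_scaleR)
    have "coord (restrict_c00 (supp (w l)) ?y) c = 2 ^ l * coord (w l) c"
      using l(1) by (simp add: restrict_block_sum[OF t w(2)])
    then have "coord ?y c = 2 ^ l * coord (w l) c"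
      using l(2) by simp
    then have "\<bar>coord ?y c\<bar> = 2 ^ l * \<bar>coord (w l) c\<bar>"
      by (simp add: abs_mult)
    also have "\<dots> \<le> 2 ^ l * 1"
      using coord_le_norm[of "w l" c] w(1) by (intro mult_left_mono) auto
    also have "\<dots> \<le> 2 ^ m / 2"
      using power_increasing[of "Suc l" m "2::real"] l(1) by simp
    also have "\<dots> \<le> (1 + d) * 2 ^ m / 2"
      using d by simp
    finally show ?thesis .
  qed (use d in \<open>simp add: supp_def\<close>)
next
  let ?y = "\<Sum>l<m. (2::real) ^ l *\<^sub>R w l"
  fix n E
  assume E: "admissible n E"
  define hit where "hit l \<longleftrightarrow> (\<exists>i\<in>{1..n}. E i \<inter> supp (w l) \<noteq> {})" for l
  define k where "k = (LEAST l. hit l)"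
  have piece: "(\<Sum>i=1..n. norm (restrict_c00 (E i) (w l))) \<le> (if l < k then 0 else if l = k then 2 else 1 + d)" for l
  proof -
    \<comment> \<open>If nothing is hit at all, \<open>k\<close> is an arbitrary number, and the last case applies.\<close>
    consider "l < k" | "l = k" | "k < l" "hit l" | "\<not> hit l" by (meson linorder_neqE_nat)
    then show ?thesis
    proof cases
      case 1
      then have "\<forall>i\<in>{1..n}. E i \<inter> supp (w l) = {}"
        using not_less_Least[of l hit] unfolding k_def hit_def by blast
      then show ?thesis using 1 by (simp add: restrict_eq_zero)
    next
      case 2
      then show ?thesis using admissible_sum_le[OF E, of "w l"] w(1) by simp
    next
      case 3
      then have "hit k"
        unfolding k_def by (intro LeastI)
      then obtain i c where ic: "i \<in> {1..n}" "c \<in> E i" "c \<in> supp (w k)"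
        unfolding hit_def by blast
      have "finite (E 1)" "E 1 \<noteq> {}" "n \<le> Min (E 1)"
        using E by (auto simp: admissible_def)
      then have "Min (E 1) \<in> E 1" by simp
      then have "Min (E 1) \<le> c"
        using admissible_less[OF E, of 1 i "Min (E 1)" c] ic \<open>finite (E 1)\<close>
        by (cases "i = 1") auto
      moreover have "c < t (Suc k)" using ic(3) w(2)[of k] by auto
      moreover have "t (Suc k) \<le> t l" using 3(1) t by (simp add: strict_mono_less_eq)
      ultimately have "n \<le> t l" using \<open>n \<le> Min (E 1)\<close> by linarith
      then have "flat n d (w l)" by (rule fl)
      then have "(\<Sum>i=1..n. norm (restrict_c00 (E i) (w l))) \<le> 1 + d"
        unfolding flat_def using admissible_less[OF E] by blast
      then show ?thesis using 3(1) by simp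
    next
      case 4
      then show ?thesis using d by (simp add: hit_def restrict_eq_zero)
    qed
  qed
  have "(\<Sum>i=1..n. norm (restrict_c00 (E i) ?y)) \<le> (\<Sum>i=1..n. \<Sum>l<m. 2 ^ l * norm (restrict_c00 (E i) (w l)))"
    unfolding restrict_sum restrict_c00_scaleR
    by (intro sum_mono order_trans[OF norm_sum]) simp
  also have "\<dots> = (\<Sum>l<m. 2 ^ l * (\<Sum>i=1..n. norm (restrict_c00 (E i) (w l))))"
    unfolding sum_distrib_left by (rule sum.swap)
  also have "\<dots> \<le> (\<Sum>l<m. 2 ^ l * (if l < k then 0 else if l = k then 2 else 1 + d))"
    by (intro sum_mono mult_left_mono piece) simp
  also have "\<dots> \<le> (1 + d) * 2 ^ m"
    by (rule geometric_step_sum_le[OF d])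
  finally show "(\<Sum>i=1..n. norm (restrict_c00 (E i) ?y)) \<le> 2 * ((1 + d) * 2 ^ m / 2)"
    by simp
qed

text \<open>
  The sets \<open>F 0, F 1, \<dots>\<close> are listed from right to left because the pieces of the vectors to be
  constructed grow to the right; the \<open>p\<close> heaviest pieces are then always an initial segment.
\<close>

definition top_heavy :: "nat \<Rightarrow> real \<Rightarrow> c00 \<Rightarrow> (nat \<Rightarrow> nat set) \<Rightarrow> bool" where
  "top_heavy m d y F \<longleftrightarrow>
     (\<forall>l<m. F l \<subseteq> supp y) \<and>
     (\<forall>l l' a b. l < l' \<longrightarrow> l' < m \<longrightarrow> a \<in> F l \<longrightarrow> b \<in> F l' \<longrightarrow> b < a) \<and>
     (\<forall>p\<le>m. 2 * (1 - (1/2) ^ p) / (1 + d) \<le> (\<Sum>l<p. norm (restrict_c00 (F l) y)))"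

lemma top_heavyD:
  assumes "top_heavy m d y F"
  shows "l < m \<Longrightarrow> F l \<subseteq> supp y"
    and "l < l' \<Longrightarrow> l' < m \<Longrightarrow> a \<in> F l \<Longrightarrow> b \<in> F l' \<Longrightarrow> b < a"
    and "p \<le> m \<Longrightarrow> 2 * (1 - (1/2) ^ p) / (1 + d) \<le> (\<Sum>l<p. norm (restrict_c00 (F l) y))"
proof -
  note * = assms[unfolded top_heavy_def]
  show "l < m \<Longrightarrow> F l \<subseteq> supp y"
    using conjunct1[OF *] by blast
  show "l < l' \<Longrightarrow> l' < m \<Longrightarrow> a \<in> F l \<Longrightarrow> b \<in> F l' \<Longrightarrow> b < a"
    using conjunct1[OF conjunct2[OF *]] by blast
  show "p \<le> m \<Longrightarrow> 2 * (1 - (1/2) ^ p) / (1 + d) \<le> (\<Sum>l<p. norm (restrict_c00 (F l) y))"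
    using conjunct2[OF conjunct2[OF *]] by (rule allE) (erule mp)
qed

text \<open>
  The vector is a multiple of the sum of the \<open>2\<^sup>l w\<^sub>l\<close>, and its pieces are the summands.
\<close>

lemma top_heavy_vector_exists:
  assumes V: "deep V" and d: "0 < d" and m: "1 \<le> m"
  obtains y F where "y \<in> V" "norm y = 1" "supp y \<subseteq> {n..}"
    "top_heavy m d y F"
proof -
  obtain t w where t: "strict_mono t" "t 0 = n"
    and w: "\<And>l. w l \<in> V \<and> norm (w l) = 1 \<and> (\<forall>q\<le>t l. flat q d (w l))"
    and sw: "\<And>l. supp (w l) \<subseteq> {t l..<t (Suc l)}"
    by (rule block_selection[where Q = "\<lambda>_ k w. w \<in> V \<and> norm w = 1 \<and> (\<forall>q\<le>k. flat q d w)" and n = n,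
        OF flat_vector_exists[OF V d]]) (rule that)
  have ww: "a < b" if "i < j" "a \<in> supp (w i)" "b \<in> supp (w j)" for i j a b
    using strict_mono_blocks_less[OF t(1) sw sw] that by blast
  define z where "z = (\<Sum>l<m. (2::real) ^ l *\<^sub>R w l)"
  have rz: "restrict_c00 (supp (w l)) z = 2 ^ l *\<^sub>R w l" if "l < m" for l
    using that by (simp add: z_def restrict_block_sum[OF t(1) sw])
  have z_le: "norm z \<le> (1 + d) * 2 ^ m / 2"
    unfolding z_def using t w sw d by (intro norm_growing_flat_sum_le) auto
  have "norm (restrict_c00 (supp (w 0)) z) = 1"
    using m w by (simp add: rz)
  then have z_pos: "0 < norm z"
    using norm_restrict_le[of "supp (w 0)" z] by linarith
  define F where "F l = supp (w (m - 1 - l))" for l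
  show thesis
  proof (rule that[of "(1 / norm z) *\<^sub>R z" F])
    show "(1 / norm z) *\<^sub>R z \<in> V"
      unfolding z_def using V w by (auto simp: deep_def intro!: subspace_scale subspace_sum)
    show "norm ((1 / norm z) *\<^sub>R z) = 1" using z_pos by simp
    have nt: "n \<le> t l" for l using t by (metis strict_mono_less_eq le0)
    have "supp (w l) \<subseteq> {n..}" for l
      by (rule order_trans[OF sw]) (use nt[of l] in auto)
    moreover have "supp ((1 / norm z) *\<^sub>R z) \<subseteq> (\<Union>l<m. supp (w l))"
      using supp_sum[of "\<lambda>l. (2::real) ^ l *\<^sub>R w l" "{..<m}"] by (auto simp: z_def supp_scaleR)
    ultimately show "supp ((1 / norm z) *\<^sub>R z) \<subseteq> {n..}"
      by blast
    show "top_heavy m d ((1 / norm z) *\<^sub>R z) F"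
      unfolding top_heavy_def
    proof (intro conjI allI impI)
      fix l assume "l < m"
      show "F l \<subseteq> supp ((1 / norm z) *\<^sub>R z)"
      proof
        fix c assume c: "c \<in> F l"
        have "m - 1 - l < m" using \<open>l < m\<close> by simp
        from arg_cong[OF rz[OF this], of "\<lambda>x. coord x c"] c
        have "coord z c = 2 ^ (m - 1 - l) * coord (w (m - 1 - l)) c"
          by (simp add: F_def)
        then show "c \<in> supp ((1 / norm z) *\<^sub>R z)"
          using c z_pos by (auto simp: F_def supp_def)
      qed
    next
      fix l l' a b assume "l < l'" "l' < m" "a \<in> F l" "b \<in> F l'"
      then show "b < a"
        using ww[of "m - 1 - l'" "m - 1 - l" b a] by (auto simp: F_def)
    next
      fix p assume p: "p \<le> m"
      have "2 * (1 - (1/2) ^ p) / (1 + d) = (\<Sum>l<p. (1/2) ^ l) / (1 + d)"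
        by (simp add: sum_gp_strict)
      also have "\<dots> = (\<Sum>l<p. 2 ^ (m - 1 - l)) / ((1 + d) * 2 ^ m / 2)"
      proof -
        have "(2::real) ^ (m - 1 - l) = (2 ^ m / 2) * (1/2) ^ l" if "l < p" for l
        proof -
          have "m = Suc (m - 1 - l + l)" using that p by simp
          then have "(2::real) ^ m = 2 * 2 ^ (m - 1 - l) * 2 ^ l"
            by (metis power_Suc power_add mult.assoc)
          then show ?thesis by (simp add: power_one_over)
        qed
        then have "(\<Sum>l<p. (2::real) ^ (m - 1 - l)) = (2 ^ m / 2) * (\<Sum>l<p. (1/2) ^ l)"
          unfolding sum_distrib_left by (intro sum.cong) auto
        moreover have "(1 + d) * 2 ^ m / 2 = (2 ^ m / 2) * (1 + d)"
          by simp
        ultimately show ?thesis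
          by (simp only: nonzero_mult_divide_mult_cancel_left[of "2 ^ m / 2 :: real"] power_not_zero
              divide_eq_0_iff zero_neq_numeral not_False_eq_True simp_thms)
      qed
      also have "\<dots> \<le> (\<Sum>l<p. 2 ^ (m - 1 - l)) / norm z"
        using z_pos z_le d by (intro divide_left_mono sum_nonneg mult_pos_pos) auto
      also have "\<dots> = (\<Sum>l<p. norm (restrict_c00 (F l) ((1 / norm z) *\<^sub>R z)))"
        unfolding sum_divide_distrib
      proof (rule sum.cong)
        fix l assume "l \<in> {..<p}"
        then have "m - 1 - l < m" using p by auto
        from rz[OF this] show "2 ^ (m - 1 - l) / norm z = norm (restrict_c00 (F l) ((1 / norm z) *\<^sub>R z))"
          using w by (simp add: F_def restrict_c00_scaleR)
      qed simp
      finally show "2 * (1 - (1/2) ^ p) / (1 + d) \<le> (\<Sum>l<p. norm (restrict_c00 (F l) ((1 / norm z) *\<^sub>R z)))" .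
    qed
  qed
qed


section \<open>Spreading of top-heavy blocks\<close>

text \<open>
  Each of the \<open>n\<close> blocks is cut into its \<open>n\<close> heaviest pieces. As the \<open>i\<close>-th block starts at or beyond
  \<open>(i + 1)\<^sup>2\<close>, these \<open>n\<^sup>2\<close> pieces are admissible together. The constant \<open>3\<close> comes from
  \<open>(1 - h) / (1 + 2 h) \<ge> 1 - 3 h\<close> with \<open>h = 2\<^sup>-\<^sup>n\<close>: the pieces miss \<open>h\<close>, and the normalization of the
  blocks costs a factor of at most \<open>1 + 2 h\<close>, their indices (counted from \<open>0\<close>) being at least \<open>n - 1\<close>.
\<close>

lemma top_heavy_blocks_sum_ge:
  fixes a :: "nat \<Rightarrow> real"
  assumes y: "block_sequence t y" and start: "\<And>i. supp (y i) \<subseteq> {(i + 1)\<^sup>2..}"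
    and F: "\<And>i. top_heavy (Suc i) ((1/2) ^ i) (y i) (F i)"
    and k: "strict_mono_on {..<n} k" and n: "n \<le> Suc (k 0)"
  shows "(1 - 3 * (1/2) ^ n) * (\<Sum>i<n. \<bar>a i\<bar>) \<le> norm (\<Sum>i<n. a i *\<^sub>R y (k i))"
proof -
  let ?z = "\<Sum>i<n. a i *\<^sub>R y (k i)"
  let ?h = "(1/2::real) ^ n"
  have t: "strict_mono t" and sy: "\<And>i. supp (y i) \<subseteq> {t i..<t (Suc i)}"
    using y by (auto simp: block_sequence_def)
  have nk: "n \<le> Suc (k i)" if "i < n" for i
  proof -
    have "k 0 \<le> k i"
      using k that by (cases "i = 0") (auto simp: strict_mono_on_def intro: less_imp_le)
    then show ?thesis using n by simp
  qed
  have Fy: "F (k i) l \<subseteq> supp (y (k i))" if "i < n" "l < n" for i l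
    by (rule top_heavyD(1)[OF F]) (use nk[OF that(1)] that(2) in linarith)
  have kk: "k i < k j" if "i < j" "j < n" for i j
    using strict_mono_onD[OF k, of i j] that by simp
  have yy: "b < c" if "i < j" "j < n" "b \<in> supp (y (k i))" "c \<in> supp (y (k j))" for i j b c
    by (rule strict_mono_blocks_less[OF t sy sy kk[OF that(1,2)] that(3,4)])
  have restr: "restrict_c00 (F (k i) l) ?z = a i *\<^sub>R restrict_c00 (F (k i) l) (y (k i))"
    if i: "i < n" and l: "l < n" for i l
  proof -
    have "restrict_c00 (F (k i) l) (y (k j)) = 0" if "j < n" "j \<noteq> i" for j
    proof -
      have "supp (y (k i)) \<inter> supp (y (k j)) = {}"
        using yy[of i j] yy[of j i] that i by (metis disjoint_iff less_irrefl linorder_neqE_nat)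
      then show ?thesis using Fy[OF i l] by (intro restrict_eq_zero) blast
    qed
    then have "restrict_c00 (F (k i) l) ?z = (\<Sum>j<n. if j = i then a i *\<^sub>R restrict_c00 (F (k i) l) (y (k i)) else 0)"
      unfolding restrict_sum by (intro sum.cong) (auto simp: restrict_c00_scaleR)
    then show ?thesis using i by simp
  qed
  have one: "2 * (1 - 3 * ?h) \<le> (\<Sum>l<n. norm (restrict_c00 (F (k i) l) (y (k i))))" if i: "i < n" for i
  proof -
    have h: "0 < ?h" "?h \<le> 1" by (auto simp: power_le_one)
    have "(1/2::real) ^ k i = 2 * (1/2) ^ Suc (k i)" by simp
    also have "\<dots> \<le> 2 * ?h"
      using nk[OF i] by (intro mult_left_mono power_decreasing) auto
    finally have hk: "(1/2::real) ^ k i \<le> 2 * ?h" .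
    have "(1 - 3 * ?h) * (1 + 2 * ?h) \<le> 1 - ?h"
      using h by (simp add: algebra_simps)
    moreover have "0 < 1 + 2 * ?h"
      using h(1) by linarith
    ultimately have "1 - 3 * ?h \<le> (1 - ?h) / (1 + 2 * ?h)"
      by (simp only: pos_le_divide_eq)
    also have "\<dots> \<le> (1 - ?h) / (1 + (1/2) ^ k i)"
      using hk h by (intro divide_left_mono mult_pos_pos add_pos_pos) auto
    finally have "2 * (1 - 3 * ?h) \<le> 2 * ((1 - ?h) / (1 + (1/2) ^ k i))"
      by (rule mult_left_mono) simp
    also have "\<dots> = 2 * (1 - ?h) / (1 + (1/2) ^ k i)"
      by (rule times_divide_eq_right)
    also have "\<dots> \<le> (\<Sum>l<n. norm (restrict_c00 (F (k i) l) (y (k i))))"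
      by (rule top_heavyD(3)[OF F nk[OF i]])
    finally show ?thesis .
  qed
  have "2 * ((1 - 3 * ?h) * (\<Sum>i<n. \<bar>a i\<bar>)) = (\<Sum>i<n. \<bar>a i\<bar> * (2 * (1 - 3 * ?h)))"
    by (subst sum_distrib_right[symmetric]) (simp only: mult.commute mult.left_commute)
  also have "\<dots> \<le> (\<Sum>i<n. \<bar>a i\<bar> * (\<Sum>l<n. norm (restrict_c00 (F (k i) l) (y (k i)))))"
    by (intro sum_mono mult_left_mono one) auto
  also have "\<dots> = (\<Sum>i<n. \<Sum>l<n. norm (restrict_c00 (F (k i) l) ?z))"
    by (intro sum.cong) (auto simp: restr sum_distrib_left)
  also have "\<dots> = (\<Sum>(i, l)\<in>{..<n} \<times> {..<n}. norm (restrict_c00 (F (k i) l) ?z))"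
    by (rule sum.cartesian_product)
  also have "\<dots> = (\<Sum>p\<in>{..<n} \<times> {..<n}. norm (restrict_c00 (F (k (fst p)) (snd p)) ?z))"
    by (simp add: case_prod_unfold)
  also have "\<dots> \<le> 2 * norm ?z"
  proof (rule successive_sum_le)
    fix p q :: "nat \<times> nat"
    assume pq: "p \<in> {..<n} \<times> {..<n}" "q \<in> {..<n} \<times> {..<n}" "p \<noteq> q"
    obtain i l j l' where il: "p = (i, l)" "q = (j, l')" "i < n" "l < n" "j < n" "l' < n"
      using pq by auto
    consider "i < j" | "j < i" | "i = j" "l < l'" | "i = j" "l' < l"
      using pq(3) il(1,2) by (metis linorder_neqE_nat)
    then have "(\<forall>a\<in>F (k i) l. \<forall>b\<in>F (k j) l'. a < b) \<or> (\<forall>a\<in>F (k i) l. \<forall>b\<in>F (k j) l'. b < a)"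
    proof cases
      case 1
      show ?thesis
        by (intro disjI1 ballI yy[OF 1 il(5)] subsetD[OF Fy[OF il(3,4)]] subsetD[OF Fy[OF il(5,6)]])
    next
      case 2
      show ?thesis
        by (intro disjI2 ballI yy[OF 2 il(3)] subsetD[OF Fy[OF il(3,4)]] subsetD[OF Fy[OF il(5,6)]])
    next
      case 3
      then have "l' < Suc (k i)" using nk[OF il(3)] il(6) by simp
      then show ?thesis using 3 top_heavyD(2)[OF F[of "k i"]] by blast
    next
      case 4
      then have "l < Suc (k i)" using nk[OF il(3)] il(4) by simp
      then show ?thesis using 4 top_heavyD(2)[OF F[of "k i"]] by blast
    qed
    then show "(\<forall>a\<in>F (k (fst p)) (snd p). \<forall>b\<in>F (k (fst q)) (snd q). a < b)
        \<or> (\<forall>a\<in>F (k (fst p)) (snd p). \<forall>b\<in>F (k (fst q)) (snd q). b < a)"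
      by (simp add: il)
  next
    fix p assume "p \<in> {..<n} \<times> {..<n}"
    then obtain i l where il: "p = (i, l)" "i < n" "l < n" by auto
    have "n * n \<le> Suc (k i) * Suc (k i)"
      using nk[OF il(2)] by (intro mult_le_mono)
    then have "n * n \<le> (k i + 1)\<^sup>2"
      by (simp add: power2_eq_square)
    then have "supp (y (k i)) \<subseteq> {n * n..}"
      by (intro order_trans[OF start]) simp
    then show "F (k (fst p)) (snd p) \<subseteq> {card ({..<n} \<times> {..<n})..}"
      using Fy[OF il(2,3)] il(1) by auto
  qed simp
  finally show ?thesis by simp
qed


section \<open>Basic sequences and the basis of \<open>\<ell>\<^sub>1\<close>\<close>

text \<open>
  The expansion may be taken as long as desired, so that two elements of the span can be compared
  on a common initial segment.
\<close>

lemma span_range_sum: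
  fixes x :: "nat \<Rightarrow> 'a::real_vector"
  assumes "z \<in> span (range x)"
  obtains n c where "\<And>m. n \<le> m \<Longrightarrow> z = (\<Sum>i<m. c i *\<^sub>R x i)"
proof -
  have "\<exists>n c. \<forall>m\<ge>n. z = (\<Sum>i<m. c i *\<^sub>R x i)"
    using assms
  proof (induction rule: span_induct_alt)
    case base
    show ?case by (intro exI[of _ 0] exI[of _ "\<lambda>_. 0"]) simp
  next
    case (step r v z)
    then obtain k n c where v: "v = x k" and c: "\<forall>m\<ge>n. z = (\<Sum>i<m. c i *\<^sub>R x i)"
      by blast
    define c' where "c' i = (if i = k then r else 0) + c i" for i
    have "r *\<^sub>R v + z = (\<Sum>i<m. c' i *\<^sub>R x i)" if "m \<ge> max n (Suc k)" for m
    proof -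
      have "(\<Sum>i<m. c' i *\<^sub>R x i) = (\<Sum>i<m. (if i = k then r *\<^sub>R x k else 0)) + (\<Sum>i<m. c i *\<^sub>R x i)"
        unfolding sum.distrib[symmetric] by (intro sum.cong) (auto simp: c'_def scaleR_add_left)
      then show ?thesis using that c by (simp add: v)
    qed
    then show ?case
      by (intro exI[of _ "max n (Suc k)"] exI[of _ c']) blast
  qed
  then show thesis using that by blast
qed

text \<open>
  Grunblum's criterion: a sequence of nonzero vectors is basic if its partial sum projections are
  uniformly bounded. They extend to the closed span by continuity, and a limit of their values
  along approximating finite sums gives the expansion of a point.
\<close>

lemma basic_sequenceI:
  fixes x :: "nat \<Rightarrow> 'a::banach"
  assumes nz: "\<And>i. x i \<noteq> 0"
    and K: "\<And>m n a. m \<le> n \<Longrightarrow> norm (\<Sum>i<m. a i *\<^sub>R x i) \<le> K * norm (\<Sum>i<n. a i *\<^sub>R x i)"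
  shows "basic_sequence x"
  unfolding basic_sequence_def
proof (intro ballI ex_ex1I)
  fix a b :: "nat \<Rightarrow> real" and v
  assume "(\<lambda>i. a i *\<^sub>R x i) sums v" "(\<lambda>i. b i *\<^sub>R x i) sums v"
  then have "(\<lambda>i. (a i - b i) *\<^sub>R x i) sums 0"
    using sums_diff[of "\<lambda>i. a i *\<^sub>R x i" v "\<lambda>i. b i *\<^sub>R x i" v] by (simp add: scaleR_diff_left)
  then have "(\<lambda>n. \<Sum>i<n. (a i - b i) *\<^sub>R x i) \<longlonglongrightarrow> 0"
    by (simp add: sums_def)
  then have "(\<lambda>n. K * norm (\<Sum>i<n. (a i - b i) *\<^sub>R x i)) \<longlonglongrightarrow> K * norm (0::'a)"
    by (intro tendsto_intros)
  then have "norm (\<Sum>i<m. (a i - b i) *\<^sub>R x i) \<le> K * norm (0::'a)" for m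
    by (rule LIMSEQ_le_const) (intro exI[of _ m] allI impI K)
  then have z: "(\<Sum>i<m. (a i - b i) *\<^sub>R x i) = 0" for m
    by simp
  have "(a i - b i) *\<^sub>R x i = 0" for i
    using z[of "Suc i"] z[of i] by simp
  then show "a = b" using nz by auto
next
  fix v assume "v \<in> closure (span (range x))"
  then obtain z where z: "\<And>j. z j \<in> span (range x)" "z \<longlonglongrightarrow> v"
    unfolding closure_sequential by blast
  have "\<forall>j. \<exists>c. \<exists>n. \<forall>m\<ge>n. z j = (\<Sum>i<m. c i *\<^sub>R x i)"
  proof
    fix j
    show "\<exists>c. \<exists>n. \<forall>m\<ge>n. z j = (\<Sum>i<m. c i *\<^sub>R x i)"
      by (rule span_range_sum[OF z(1)[of j]]) blast
  qed
  then obtain c where "\<forall>j. \<exists>n. \<forall>m\<ge>n. z j = (\<Sum>i<m. c j i *\<^sub>R x i)"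
    by metis
  then obtain L where L: "\<And>j m. L j \<le> m \<Longrightarrow> z j = (\<Sum>i<m. c j i *\<^sub>R x i)"
    by metis
  define P where "P m j = (\<Sum>i<m. c j i *\<^sub>R x i)" for m j
  have P_diff: "norm (P m j - P m l) \<le> K * norm (z j - z l)" for m j l
  proof -
    define n where "n = max m (max (L j) (L l))"
    have "z j - z l = (\<Sum>i<n. (c j i - c l i) *\<^sub>R x i)"
      by (simp add: L[of j n] L[of l n] n_def scaleR_diff_left sum_subtractf)
    moreover have "P m j - P m l = (\<Sum>i<m. (c j i - c l i) *\<^sub>R x i)"
      by (simp add: P_def scaleR_diff_left sum_subtractf)
    ultimately show ?thesis
      using K[of m n "\<lambda>i. c j i - c l i"] by (simp add: n_def)
  qed
  have K_pos: "0 < K"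
  proof -
    have "norm (x 0) \<le> K * norm (x 0)" "0 < norm (x 0)"
      using K[of 1 1 "\<lambda>_. 1"] nz[of 0] by auto
    then show ?thesis by (metis linorder_not_le mult_nonpos_nonneg norm_ge_zero order_trans)
  qed
  have "Cauchy z" using z(2) by (rule LIMSEQ_imp_Cauchy)
  have "Cauchy (P m)" for m
  proof (rule CauchyI)
    fix e :: real assume "0 < e"
    then obtain M where "\<And>j l. j \<ge> M \<Longrightarrow> l \<ge> M \<Longrightarrow> norm (z j - z l) < e / K"
      using CauchyD[OF \<open>Cauchy z\<close>, of "e / K"] K_pos by auto
    then have "norm (P m j - P m l) < e" if "j \<ge> M" "l \<ge> M" for j l
      using P_diff[of m j l] that K_pos by (fastforce simp: field_simps)
    then show "\<exists>M. \<forall>j\<ge>M. \<forall>l\<ge>M. norm (P m j - P m l) < e" by blast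
  qed
  then have "\<forall>m. \<exists>p. P m \<longlonglongrightarrow> p"
    using Cauchy_convergent by (auto simp: convergent_def)
  then obtain p where p: "\<And>m. P m \<longlonglongrightarrow> p m" by metis
  have "\<forall>i. \<exists>a. p (Suc i) - p i = a *\<^sub>R x i"
  proof
    fix i
    have lim: "(\<lambda>j. c j i *\<^sub>R x i) \<longlonglongrightarrow> p (Suc i) - p i"
      using tendsto_diff[OF p[of "Suc i"] p[of i]] by (simp add: P_def)
    have "Cauchy (\<lambda>j. c j i)"
    proof (rule CauchyI)
      fix e :: real assume "0 < e"
      then have "0 < e * norm (x i)" using nz by simp
      then obtain M where M: "\<forall>j\<ge>M. \<forall>l\<ge>M. norm (c j i *\<^sub>R x i - c l i *\<^sub>R x i) < e * norm (x i)"
        using CauchyD[OF LIMSEQ_imp_Cauchy[OF lim]] by blast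
      have "norm (c j i *\<^sub>R x i - c l i *\<^sub>R x i) = norm (c j i - c l i) * norm (x i)" for j l
        by (simp flip: scaleR_diff_left)
      with M show "\<exists>M. \<forall>j\<ge>M. \<forall>l\<ge>M. norm (c j i - c l i) < e"
        using nz[of i] by auto
    qed
    then obtain a where "(\<lambda>j. c j i) \<longlonglongrightarrow> a"
      using Cauchy_convergent by (auto simp: convergent_def)
    then have "(\<lambda>j. c j i *\<^sub>R x i) \<longlonglongrightarrow> a *\<^sub>R x i"
      by (intro tendsto_intros)
    then show "\<exists>a. p (Suc i) - p i = a *\<^sub>R x i"
      using LIMSEQ_unique[OF lim] by blast
  qed
  then obtain a where a: "\<And>i. p (Suc i) - p i = a i *\<^sub>R x i" by metis
  have "P 0 = (\<lambda>_. 0)"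
    by (rule ext) (simp add: P_def)
  then have p0: "p 0 = 0"
    using LIMSEQ_unique[OF p[of 0], of 0] by simp
  have pa: "(\<Sum>i<m. a i *\<^sub>R x i) = p m" for m
  proof (induction m)
    case (Suc m)
    then show ?case using a[of m] by (simp add: algebra_simps)
  qed (simp add: p0)
  have close: "norm (p m - P m j) \<le> K * norm (v - z j)" for m j
  proof (rule LIMSEQ_le)
    show "(\<lambda>l. norm (P m l - P m j)) \<longlonglongrightarrow> norm (p m - P m j)"
      by (intro tendsto_intros p)
    show "(\<lambda>l. K * norm (z l - z j)) \<longlonglongrightarrow> K * norm (v - z j)"
      by (intro tendsto_intros z)
  qed (use P_diff in blast)
  have "p \<longlonglongrightarrow> v"
  proof (rule LIMSEQ_I)
    fix e :: real assume "0 < e"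
    then obtain j where j: "norm (z j - v) < e / (K + 1)"
      using LIMSEQ_D[OF z(2), of "e / (K + 1)"] K_pos by fastforce
    have "norm (p m - v) < e" if "L j \<le> m" for m
    proof -
      have "P m j = z j" using L[OF that] by (simp add: P_def)
      then have "norm (p m - v) \<le> K * norm (v - z j) + norm (z j - v)"
        using close[of m j] norm_triangle_ineq[of "p m - z j" "z j - v"] by simp
      also have "\<dots> = (K + 1) * norm (z j - v)"
        by (simp add: norm_minus_commute algebra_simps)
      also have "\<dots> < e"
        using j K_pos by (simp add: field_simps)
      finally show ?thesis .
    qed
    then show "\<exists>no. \<forall>n\<ge>no. norm (p n - v) < e" by blast
  qed
  then show "\<exists>a. (\<lambda>i. a i *\<^sub>R x i) sums v"
    by (intro exI[of _ a]) (simp add: sums_def pa)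
qed

text \<open>
  The vector \<open>rademacher i\<close> takes the value \<open>-1\<close> at \<open>j\<close> iff the \<open>i\<close>-th binary digit of \<open>j\<close> is \<open>1\<close>. As every
  finite pattern of signs occurs at some \<open>j\<close>, this is a copy of the unit vector basis of \<open>\<ell>\<^sub>1\<close>.
\<close>

definition rademacher :: "nat \<Rightarrow> ell_infinity" where
  "rademacher i = Bcontfun (\<lambda>j. if i \<in> set_decode j then - 1 else 1)"

lemma apply_rademacher: "apply_bcontfun (rademacher i) j = (if i \<in> set_decode j then - 1 else 1)"
proof -
  have "(\<lambda>j. if i \<in> set_decode j then - 1 else (1::real)) \<in> bcontfun"
    by (rule bcontfun_normI[of _ 1]) (auto simp: continuous_on_discrete)
  then show ?thesis
    unfolding rademacher_def by (simp add: Bcontfun_inverse)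
qed

lemma isometric_rademacher: "isometric_to_ell1_basis rademacher"
  unfolding isometric_to_ell1_basis_def
proof (intro allI antisym)
  fix n and a :: "nat \<Rightarrow> real"
  have norm1: "norm (rademacher i) \<le> 1" for i
    by (rule norm_bound) (simp add: apply_rademacher)
  have "norm (a i *\<^sub>R rademacher i) \<le> \<bar>a i\<bar>" for i
    using mult_left_mono[OF norm1[of i], of "\<bar>a i\<bar>"] by simp
  then show "norm (\<Sum>i<n. a i *\<^sub>R rademacher i) \<le> (\<Sum>i<n. \<bar>a i\<bar>)"
    by (intro order_trans[OF norm_sum] sum_mono) auto
  define j where "j = set_encode {i. i < n \<and> a i < 0}"
  have j: "set_decode j = {i. i < n \<and> a i < 0}"
    by (simp add: j_def)
  have ap: "apply_bcontfun (\<Sum>i<m. a i *\<^sub>R rademacher i) j = (\<Sum>i<m. a i * apply_bcontfun (rademacher i) j)" for m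
    by (induction m) simp_all
  have "(\<Sum>i<n. \<bar>a i\<bar>) = apply_bcontfun (\<Sum>i<n. a i *\<^sub>R rademacher i) j"
    unfolding ap by (intro sum.cong) (auto simp: apply_rademacher j)
  also have "\<dots> \<le> norm (\<Sum>i<n. a i *\<^sub>R rademacher i)"
    using norm_bounded[of "\<Sum>i<n. a i *\<^sub>R rademacher i" j] by simp
  finally show "(\<Sum>i<n. \<bar>a i\<bar>) \<le> norm (\<Sum>i<n. a i *\<^sub>R rademacher i)" .
qed

lemma basic_sequence_of_isometric_ell1:
  fixes s :: "nat \<Rightarrow> 'a::banach"
  assumes "isometric_to_ell1_basis s"
  shows "basic_sequence s"
proof (rule basic_sequenceI)
  have s: "norm (\<Sum>i<n. a i *\<^sub>R s i) = (\<Sum>i<n. \<bar>a i\<bar>)" for n and a :: "nat \<Rightarrow> real"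
    using assms by (simp add: isometric_to_ell1_basis_def)
  show "s i \<noteq> 0" for i
    using s[of "\<lambda>j. if j = i then 1 else 0" "Suc i"] by (auto simp: if_distrib cong: if_cong)
  show "norm (\<Sum>i<m. a i *\<^sub>R s i) \<le> 1 * norm (\<Sum>i<n. a i *\<^sub>R s i)" if "m \<le> n" for m n a
    unfolding s mult_1 using that by (intro sum_mono2) auto
qed


section \<open>Block vectors near a subspace of Tsirelson's space\<close>

lemma coord_tendsto:
  assumes "Cauchy X"
  shows "(\<lambda>n. coord (X n) i) \<longlonglongrightarrow> lim (\<lambda>n. coord (X n) i)"
proof -
  have "Cauchy (\<lambda>n. coord (X n) i)"
  proof (rule CauchyI)
    fix e :: real assume "0 < e"
    then obtain M where M: "\<forall>m\<ge>M. \<forall>n\<ge>M. norm (X m - X n) < e"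
      using CauchyD[OF assms] by blast
    have "norm (coord (X m) i - coord (X n) i) \<le> norm (X m - X n)" for m n
      using coord_le_norm[of "X m - X n" i] by simp
    with M show "\<exists>M. \<forall>m\<ge>M. \<forall>n\<ge>M. norm (coord (X m) i - coord (X n) i) < e"
      by (meson le_less_trans)
  qed
  then show ?thesis
    by (simp add: Cauchy_convergent_iff convergent_LIMSEQ_iff)
qed

text \<open>
  The coordinate functionals extend continuously to the completion.
\<close>

lift_definition coordinate :: "nat \<Rightarrow> tsirelson \<Rightarrow> real" is "\<lambda>i X. lim (\<lambda>n. coord (X n) i)"
proof -
  fix i and X Y :: "nat \<Rightarrow> c00"
  assume XY: "cauchy_equiv X Y"
  then have "(\<lambda>n. norm (X n - Y n)) \<longlonglongrightarrow> 0"
    by (simp add: cauchy_equiv_def tendsto_norm_zero)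
  then have "(\<lambda>n. coord (X n - Y n) i) \<longlonglongrightarrow> 0"
    by (rule Lim_null_comparison[rotated]) (simp add: coord_le_norm del: coord_diff)
  moreover have "Cauchy X"
    using XY by (simp add: cauchy_equiv_def)
  ultimately have "(\<lambda>n. coord (X n) i - coord (X n - Y n) i) \<longlonglongrightarrow> lim (\<lambda>n. coord (X n) i) - 0"
    by (intro tendsto_diff coord_tendsto)
  then have "(\<lambda>n. coord (Y n) i) \<longlonglongrightarrow> lim (\<lambda>n. coord (X n) i)"
    by simp
  then show "lim (\<lambda>n. coord (X n) i) = lim (\<lambda>n. coord (Y n) i)"
    by (simp add: limI)
qed

lemma coordinate_to_completion: "coordinate i (to_completion u) = coord u i"
  by transfer (simp add: limI)

lemma coordinate_scaleR: "coordinate i (c *\<^sub>R z) = c * coordinate i z"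
proof transfer
  fix i c and Z :: "nat \<Rightarrow> c00"
  assume "cauchy_equiv Z Z"
  then have "(\<lambda>n. c * coord (Z n) i) \<longlonglongrightarrow> c * lim (\<lambda>n. coord (Z n) i)"
    by (intro tendsto_intros coord_tendsto) (simp add: cauchy_equiv_def)
  then show "lim (\<lambda>n. coord (c *\<^sub>R Z n) i) = c * lim (\<lambda>n. coord (Z n) i)"
    by (simp add: limI)
qed

lemma coordinate_add: "coordinate i (y + z) = coordinate i y + coordinate i z"
proof transfer
  fix i and Y Z :: "nat \<Rightarrow> c00"
  assume "cauchy_equiv Y Y" "cauchy_equiv Z Z"
  then have "(\<lambda>n. coord (Y n) i + coord (Z n) i) \<longlonglongrightarrow> lim (\<lambda>n. coord (Y n) i) + lim (\<lambda>n. coord (Z n) i)"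
    by (intro tendsto_intros coord_tendsto) (simp_all add: cauchy_equiv_def)
  then show "lim (\<lambda>n. coord (Y n + Z n) i) = lim (\<lambda>n. coord (Y n) i) + lim (\<lambda>n. coord (Z n) i)"
    by (simp add: limI)
qed

lemma linear_coordinate: "linear (coordinate i)"
  by (rule linearI) (simp_all add: coordinate_add coordinate_scaleR)

lemma coordinate_le_norm: "\<bar>coordinate i z\<bar> \<le> norm z"
proof transfer
  fix i and Z :: "nat \<Rightarrow> c00"
  assume Z: "cauchy_equiv Z Z"
  then have "(\<lambda>n. \<bar>coord (Z n) i\<bar>) \<longlonglongrightarrow> \<bar>lim (\<lambda>n. coord (Z n) i)\<bar>"
    by (intro tendsto_intros coord_tendsto) (simp add: cauchy_equiv_def)
  moreover have "(\<lambda>n. norm (Z n)) \<longlonglongrightarrow> lim (\<lambda>n. norm (Z n))"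
    using Z Cauchy_norm' convergent_LIMSEQ_iff unfolding cauchy_equiv_def by blast
  ultimately show "\<bar>lim (\<lambda>n. coord (Z n) i)\<bar> \<le> lim (\<lambda>n. norm (Z n))"
    by (rule LIMSEQ_le) (use coord_le_norm in blast)
qed

text \<open>
  Each functional cuts down the dimension by at most one: any vector on which \<open>f n\<close> does not
  vanish spans, together with the kernel of \<open>f n\<close>, the whole space.
\<close>

lemma common_kernel_infinite_dim:
  fixes f :: "nat \<Rightarrow> 'a::real_vector \<Rightarrow> real"
  assumes X: "subspace X" and f: "\<And>i. linear (f i)" and inf: "\<not> (\<exists>B. finite B \<and> X \<subseteq> span B)"
  shows "\<not> (\<exists>B. finite B \<and> {z\<in>X. \<forall>i<n. f i z = 0} \<subseteq> span B)"
proof (induction n)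
  case 0
  then show ?case using inf by simp
next
  case (Suc n)
  let ?X = "\<lambda>n. {z\<in>X. \<forall>i<n. f i z = 0}"
  show ?case
  proof
    assume "\<exists>B. finite B \<and> ?X (Suc n) \<subseteq> span B"
    then obtain B where B: "finite B" "?X (Suc n) \<subseteq> span B" by blast
    have "\<exists>B. finite B \<and> ?X n \<subseteq> span B"
    proof (cases "\<exists>e\<in>?X n. f n e \<noteq> 0")
      case False
      then have "?X n \<subseteq> ?X (Suc n)" by (auto simp: less_Suc_eq simp del: not_all)
      then have "?X n \<subseteq> span B" using B(2) by (rule order_trans)
      then show ?thesis using B(1) by (intro exI[of _ B] conjI)
    next
      case True
      then obtain e where e: "e \<in> X" "\<And>i. i < n \<Longrightarrow> f i e = 0" "f n e \<noteq> 0"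
        by auto
      have "z \<in> span (insert e B)" if z: "z \<in> ?X n" for z
      proof -
        let ?c = "f n z / f n e"
        have "f i (z - ?c *\<^sub>R e) = 0" if "i < Suc n" for i
        proof (cases "i = n")
          case True
          then show ?thesis using e(3) by (simp add: linear_diff[OF f] linear_scale[OF f])
        next
          case False
          then have "i < n" using that by simp
          then show ?thesis using e(2)[of i] z by (simp add: linear_diff[OF f] linear_scale[OF f])
        qed
        moreover have "z - ?c *\<^sub>R e \<in> X"
          using z e(1) X by (simp add: subspace_diff subspace_scale)
        ultimately have "z - ?c *\<^sub>R e \<in> ?X (Suc n)"
          by simp
        then have "z - ?c *\<^sub>R e \<in> span B" by (rule subsetD[OF B(2)])
        then show ?thesis unfolding span_insert by blast
      qed
      then show ?thesis using B(1) by (intro exI[of _ "insert e B"]) auto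
    qed
    then show False using Suc.IH by blast
  qed
qed

lift_definition unit_vector :: "nat \<Rightarrow> c00" is "\<lambda>i j. if j = i \<and> i \<noteq> 0 then 1 else 0"
proof -
  fix i :: nat
  have "{j. (if j = i \<and> i \<noteq> 0 then 1 else (0::real)) \<noteq> 0} \<subseteq> {i}"
    by auto
  then show "finite {j. (if j = i \<and> i \<noteq> 0 then 1 else (0::real)) \<noteq> 0}
      \<and> (if 0 = i \<and> i \<noteq> 0 then 1 else (0::real)) = 0"
    using finite_subset by auto
qed

lemma norm_initial_part_le:
  "norm (restrict_c00 {..<n} u) \<le> (\<Sum>i<n. \<bar>coord u i\<bar> * norm (unit_vector i))"
proof -
  have "restrict_c00 {..<n} u = (\<Sum>i<n. coord u i *\<^sub>R unit_vector i)"
  proof (rule c00_eqI)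
    fix j
    have unit: "coord (unit_vector i) j = (if i = j \<and> j \<noteq> 0 then 1 else 0)" for i
      by transfer auto
    have "coord (\<Sum>i<m. coord u i *\<^sub>R unit_vector i) j = (\<Sum>i<m. coord u i * coord (unit_vector i) j)" for m
      by (induction m) simp_all
    also have "(\<Sum>i<n. coord u i * coord (unit_vector i) j) = (\<Sum>i<n. if i = j then coord u j else 0)"
      by (intro sum.cong) (auto simp: unit)
    finally show "coord (restrict_c00 {..<n} u) j = coord (\<Sum>i<n. coord u i *\<^sub>R unit_vector i) j"
      by simp
  qed
  then show ?thesis
    using norm_sum[of "\<lambda>i. coord u i *\<^sub>R unit_vector i" "{..<n}"] by simp
qed

lemma normalize_near_unit:
  fixes u z :: "'a::real_normed_vector"
  assumes "norm z = 1" "norm (u - z) \<le> d" "d < 1"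
  shows "u \<noteq> 0" "norm ((1 / norm u) *\<^sub>R u - z) \<le> 2 * d"
proof -
  show u: "u \<noteq> 0" using assms by auto
  have "(1 / norm u) *\<^sub>R u - u = (1 / norm u - 1) *\<^sub>R u"
    by (simp add: scaleR_diff_left)
  then have "norm ((1 / norm u) *\<^sub>R u - u) = \<bar>1 / norm u - 1\<bar> * norm u"
    by simp
  also have "\<dots> = \<bar>1 - norm u\<bar>"
  proof -
    have "\<bar>1 / norm u - 1\<bar> * norm u = \<bar>(1 / norm u - 1) * norm u\<bar>"
      by (simp add: abs_mult)
    then show ?thesis using u by (simp add: left_diff_distrib)
  qed
  also have "\<dots> \<le> d"
    using assms(1,2) norm_triangle_ineq3[of u z] by simp
  finally show "norm ((1 / norm u) *\<^sub>R u - z) \<le> 2 * d"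
    using norm_triangle_ineq[of "(1 / norm u) *\<^sub>R u - u" "u - z"] assms(2) by simp
qed

text \<open>
  A unit vector of \<open>X\<close> whose first \<open>n\<close> coordinates vanish is approximated by a finitely supported
  vector. The first \<open>n\<close> coordinates of the latter are tiny and can be removed.
\<close>

lemma deep_approximation:
  fixes X :: "tsirelson set"
  assumes X: "subspace X" and inf: "\<not> (\<exists>B. finite B \<and> X \<subseteq> span B)" and d: "0 < d"
  shows "\<exists>u. (norm u = 1 \<and> (\<exists>v\<in>X. norm (v - to_completion u) \<le> d)) \<and> supp u \<subseteq> {n..}"
proof -
  have "\<not> {z\<in>X. \<forall>i<n. coordinate i z = 0} \<subseteq> span {}"
  proof
    assume "{z\<in>X. \<forall>i<n. coordinate i z = 0} \<subseteq> span {}"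
    then have "\<exists>B. finite B \<and> {z\<in>X. \<forall>i<n. coordinate i z = 0} \<subseteq> span B"
      by (intro exI[of _ "{}"] conjI finite.emptyI)
    then show False
      by (rule notE[OF common_kernel_infinite_dim[OF X linear_coordinate inf]])
  qed
  then obtain z0 where z0: "z0 \<in> X" "\<forall>i<n. coordinate i z0 = 0" "z0 \<noteq> 0"
    by auto
  define z where "z = (1 / norm z0) *\<^sub>R z0"
  have z: "z \<in> X" "norm z = 1" "\<And>i. i < n \<Longrightarrow> coordinate i z = 0"
    using z0 X by (auto simp: z_def coordinate_scaleR subspace_scale)
  define K where "K = 1 + (\<Sum>i<n. norm (unit_vector i))"
  have K: "1 \<le> K" by (simp add: K_def sum_nonneg)
  \<comment> \<open>Truncation multiplies the error by at most \<open>K\<close>, and normalization doubles it.\<close>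
  define e where "e = min d 1 / (4 * K)"
  have e: "0 < e" "e * K \<le> d / 4" "e * K \<le> 1 / 4" using d K by (auto simp: e_def)
  obtain w where w: "norm (to_completion w - z) < e"
  proof -
    obtain W where "(\<lambda>n. to_completion (W n)) \<longlonglongrightarrow> z"
      using completion_limit by metis
    then show thesis
      using that LIMSEQ_D[of _ z e] e(1) by blast
  qed
  have "\<bar>coord w i\<bar> \<le> e" if "i < n" for i
  proof -
    have "coord w i = coordinate i (to_completion w - z)"
      using z(3)[OF that] by (simp add: linear_diff[OF linear_coordinate] coordinate_to_completion)
    then show ?thesis using coordinate_le_norm[of i "to_completion w - z"] w by simp
  qed
  then have "(\<Sum>i<n. \<bar>coord w i\<bar> * norm (unit_vector i)) \<le> (\<Sum>i<n. e * norm (unit_vector i))"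
    by (intro sum_mono mult_right_mono) auto
  then have small: "norm (restrict_c00 {..<n} w) \<le> e * (K - 1)"
    using norm_initial_part_le[of n w] by (simp add: K_def sum_distrib_left)
  define u where "u = restrict_c00 {n..} w"
  have "w = u + restrict_c00 {..<n} w"
    by (rule c00_eqI) (auto simp: u_def)
  then have "to_completion w = to_completion u + to_completion (restrict_c00 {..<n} w)"
    by (metis to_completion_add)
  then have eq: "to_completion u - z = (to_completion w - z) - to_completion (restrict_c00 {..<n} w)"
    by simp
  then have uz: "norm (to_completion u - z) \<le> e * K"
    using norm_triangle_ineq4[of "to_completion w - z" "to_completion (restrict_c00 {..<n} w)"] w small
    unfolding eq by (simp add: right_diff_distrib)
  have u0: "u \<noteq> 0" and near: "norm ((1 / norm u) *\<^sub>R to_completion u - z) \<le> 2 * (e * K)"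
    using normalize_near_unit[OF z(2) uz] e(3) norm_to_completion[of u] by (auto simp del: norm_to_completion)
  have "norm (z - to_completion ((1 / norm u) *\<^sub>R u)) \<le> d"
    using near e(2) d by (simp add: to_completion_scaleR norm_minus_commute)
  moreover have "supp ((1 / norm u) *\<^sub>R u) \<subseteq> {n..}"
    by (auto simp: supp_def u_def)
  ultimately show ?thesis
    using u0 z(1) by (intro exI[of _ "(1 / norm u) *\<^sub>R u"]) auto
qed

lemma norm_perturbed_sum_le:
  assumes "\<And>i. i \<in> I \<Longrightarrow> norm (x i - to_completion (y i)) \<le> d i"
  shows "norm ((\<Sum>i\<in>I. a i *\<^sub>R x i) - to_completion (\<Sum>i\<in>I. a i *\<^sub>R y i)) \<le> (\<Sum>i\<in>I. \<bar>a i\<bar> * d i)"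
proof -
  have "(\<Sum>i\<in>I. a i *\<^sub>R x i) - to_completion (\<Sum>i\<in>I. a i *\<^sub>R y i)
      = (\<Sum>i\<in>I. a i *\<^sub>R (x i - to_completion (y i)))"
    by (simp add: linear_sum[OF linear_to_completion] to_completion_scaleR scaleR_diff_right sum_subtractf)
  also have "norm \<dots> \<le> (\<Sum>i\<in>I. \<bar>a i\<bar> * d i)"
    using assms by (intro order_trans[OF norm_sum] sum_mono) (simp add: mult_left_mono)
  finally show ?thesis .
qed

text \<open>
  The form in which the errors of approximation of a vector vanishing on the first \<open>k\<close> blocks
  are summed up.
\<close>

lemma geometric_tail_sum_le: "(\<Sum>i<m. if i < k then 0 else (1/2::real) ^ i) \<le> 2 * (1/2) ^ k"
proof -
  have "(\<Sum>i<m. if i < k then 0 else (1/2::real) ^ i) \<le> 2 * (1/2) ^ k - 2 * (1/2) ^ max k m"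
  proof (induction m)
    case (Suc m)
    show ?case
    proof (cases "m < k")
      case True
      then have "max k m = k" "max k (Suc m) = k" by auto
      then show ?thesis using Suc True by simp
    next
      case False
      then have "max k m = m" "max k (Suc m) = Suc m" by auto
      then show ?thesis using Suc False by simp
    qed
  qed simp
  also have "\<dots> \<le> 2 * (1/2) ^ k" by simp
  finally show ?thesis .
qed

text \<open>
  The subspace is the span of a block sequence \<open>u\<close> with \<open>u i\<close> within \<open>2\<^sup>-\<^sup>i\<close> of \<open>X\<close>. The coefficients
  of a vector in this span are bounded by its norm, and if the vector lives beyond the \<open>k\<close>-th
  block, only the errors from the \<open>k\<close>-th on contribute.
\<close>

lemma deep_subspace_exists:
  fixes X :: "tsirelson set"
  assumes X: "subspace X" and inf: "\<not> (\<exists>B. finite B \<and> X \<subseteq> span B)"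
  obtains V where "deep V"
    "\<And>d. 0 < d \<Longrightarrow> \<exists>n. \<forall>z\<in>V. supp z \<subseteq> {n..} \<longrightarrow> (\<exists>v\<in>X. norm (v - to_completion z) \<le> d * norm z)"
proof -
  have approx: "\<exists>u. (norm u = 1 \<and> (\<exists>v\<in>X. norm (v - to_completion u) \<le> (1/2) ^ i)) \<and> supp u \<subseteq> {n..}" for i n :: nat
    by (rule deep_approximation[OF X inf]) simp
  obtain t u where t: "strict_mono t" "t 0 = 0"
    and u: "\<And>i. norm (u i) = 1 \<and> (\<exists>v\<in>X. norm (v - to_completion (u i)) \<le> (1/2) ^ i)"
    and su: "\<And>i. supp (u i) \<subseteq> {t i..<t (Suc i)}"
    by (rule block_selection[where Q = "\<lambda>i _ u. norm u = 1 \<and> (\<exists>v\<in>X. norm (v - to_completion u) \<le> (1/2) ^ i)" and n = 0,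
        OF approx]) (rule that)
  have bu: "block_sequence t u"
    using t u su by (simp add: block_sequence_def)
  have "\<forall>i. \<exists>v. v \<in> X \<and> norm (v - to_completion (u i)) \<le> (1/2) ^ i"
    using u by blast
  then obtain v where v: "\<And>i. v i \<in> X" "\<And>i. norm (v i - to_completion (u i)) \<le> (1/2) ^ i"
    by metis
  show thesis
  proof (rule that[of "span (range u)"])
    show "deep (span (range u))"
      unfolding deep_def
    proof (intro conjI allI subspace_span)
      fix n
      have "n \<le> t n" using t(1) by (rule strict_mono_imp_increasing)
      then have "supp (u n) \<subseteq> {n..}" using su[of n] by auto
      moreover have "u n \<noteq> 0" using u[of n] by auto
      moreover have "u n \<in> span (range u)" by (simp add: span_base)
      ultimately show "\<exists>z\<in>span (range u). z \<noteq> 0 \<and> supp z \<subseteq> {n..}" by blast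
    qed
    fix d :: real assume "0 < d"
    then obtain k where k: "(1/2) ^ k < d / 2"
      using real_arch_pow_inv[of "d / 2" "1/2"] by auto
    show "\<exists>n. \<forall>z\<in>span (range u). supp z \<subseteq> {n..} \<longrightarrow> (\<exists>v\<in>X. norm (v - to_completion z) \<le> d * norm z)"
    proof (intro exI[of _ "t k"] ballI impI)
      fix z assume "z \<in> span (range u)" and sz: "supp z \<subseteq> {t k..}"
      then obtain m c where z: "z = (\<Sum>i<m. c i *\<^sub>R u i)"
        by (metis span_range_sum order_refl)
      have c0: "c i = 0" if "i < m" "i < k" for i
      proof -
        have "t (Suc i) \<le> t k" using that(2) t(1) by (simp add: strict_mono_less_eq)
        then have "supp (u i) \<inter> supp z = {}" using su[of i] sz by force
        then have "restrict_c00 (supp (u i)) z = 0" by (rule restrict_eq_zero)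
        then have "c i *\<^sub>R u i = 0"
          using that(1) restrict_block_sum[OF t(1) su, of i c m] by (simp add: z)
        then show ?thesis using u[of i] by auto
      qed
      have ci: "\<bar>c i\<bar> \<le> norm z" if "i < m" for i
        unfolding z by (rule block_coefficient_le[OF bu that])
      have "norm ((\<Sum>i<m. c i *\<^sub>R v i) - to_completion z) \<le> (\<Sum>i<m. \<bar>c i\<bar> * (1/2) ^ i)"
        unfolding z by (rule norm_perturbed_sum_le) (rule v)
      also have "\<dots> \<le> (\<Sum>i<m. norm z * (if i < k then 0 else (1/2) ^ i))"
        using c0 ci by (intro sum_mono) (auto simp: mult_right_mono)
      also have "\<dots> = norm z * (\<Sum>i<m. if i < k then 0 else (1/2) ^ i)"
        by (rule sum_distrib_left[symmetric])
      also have "\<dots> \<le> norm z * d"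
        using geometric_tail_sum_le[of k m] k by (intro mult_left_mono) auto
      finally have "norm ((\<Sum>i<m. c i *\<^sub>R v i) - to_completion z) \<le> d * norm z"
        by (simp add: mult.commute)
      moreover have "(\<Sum>i<m. c i *\<^sub>R v i) \<in> X"
        using X v by (intro subspace_sum subspace_scale)
      ultimately show "\<exists>v\<in>X. norm (v - to_completion z) \<le> d * norm z" by blast
    qed
  qed
qed


section \<open>The spreading model\<close>

text \<open>
  The small perturbation principle. The errors add up to at most half the norm of the
  corresponding block sum, hence partial sums are bounded by a factor of \<open>(1 + 1/2) / (1 - 1/2)\<close>.
\<close>

lemma basic_perturbed_blocks:
  assumes y: "block_sequence t y" and x: "\<And>i. norm (x i) = 1"
    and close: "\<And>i. norm (x i - to_completion (y i)) \<le> (1/2) ^ (i + 2)"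
  shows "basic_sequence x"
proof (rule basic_sequenceI)
  show "x i \<noteq> 0" for i using x[of i] by auto
  fix m n :: nat and a :: "nat \<Rightarrow> real"
  assume mn: "m \<le> n"
  let ?A = "norm (\<Sum>i<n. a i *\<^sub>R y i)"
  have t: "strict_mono t" and sy: "\<And>i. supp (y i) \<subseteq> {t i..<t (Suc i)}"
    using y by (auto simp: block_sequence_def)
  have diff: "norm ((\<Sum>i<j. a i *\<^sub>R x i) - to_completion (\<Sum>i<j. a i *\<^sub>R y i)) \<le> ?A / 2" if "j \<le> n" for j
  proof -
    have "norm ((\<Sum>i<j. a i *\<^sub>R x i) - to_completion (\<Sum>i<j. a i *\<^sub>R y i)) \<le> (\<Sum>i<j. \<bar>a i\<bar> * (1/2) ^ (i + 2))"
      by (rule norm_perturbed_sum_le) (rule close)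
    also have "\<dots> \<le> (\<Sum>i<j. ?A / 4 * (if i < 0 then 0 else (1/2) ^ i))"
      using block_coefficient_le[OF y, of _ n a] that by (intro sum_mono) (simp add: mult_right_mono)
    also have "\<dots> = ?A / 4 * (\<Sum>i<j. if i < 0 then 0 else (1/2) ^ i)"
      by (rule sum_distrib_left[symmetric])
    also have "\<dots> \<le> ?A / 4 * 2"
      using geometric_tail_sum_le[of 0 j] by (intro mult_left_mono) auto
    finally show ?thesis by simp
  qed
  have "restrict_c00 {..<t m} (y i) = (if i < m then y i else 0)" for i
  proof (cases "i < m")
    case True
    then have "t (Suc i) \<le> t m" using t by (simp add: strict_mono_less_eq)
    then show ?thesis using True sy[of i] by (auto intro!: restrict_eq_self)
  next
    case False
    then have "t m \<le> t i" using t by (simp add: strict_mono_less_eq)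
    then have "{..<t m} \<inter> supp (y i) = {}" using sy[of i] by force
    then show ?thesis using False by (simp add: restrict_eq_zero)
  qed
  then have "restrict_c00 {..<t m} (\<Sum>i<n. a i *\<^sub>R y i) = (\<Sum>i<n. if i < m then a i *\<^sub>R y i else 0)"
    unfolding restrict_sum by (intro sum.cong) (auto simp: restrict_c00_scaleR)
  also have "\<dots> = (\<Sum>i<m. a i *\<^sub>R y i)"
    using mn by (intro sum.mono_neutral_cong_right) auto
  finally have "norm (\<Sum>i<m. a i *\<^sub>R y i) \<le> ?A"
    by (metis norm_restrict_le)
  then have "norm (\<Sum>i<m. a i *\<^sub>R x i) \<le> ?A + ?A / 2"
    using diff[OF mn] norm_triangle_sub[of "\<Sum>i<m. a i *\<^sub>R x i" "to_completion (\<Sum>i<m. a i *\<^sub>R y i)"] by simp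
  moreover have "?A \<le> norm (\<Sum>i<n. a i *\<^sub>R x i) + ?A / 2"
    using diff[OF order_refl] norm_triangle_sub[of "to_completion (\<Sum>i<n. a i *\<^sub>R y i)" "\<Sum>i<n. a i *\<^sub>R x i"]
    by (simp add: norm_minus_commute)
  ultimately show "norm (\<Sum>i<m. a i *\<^sub>R x i) \<le> 3 * norm (\<Sum>i<n. a i *\<^sub>R x i)"
    by linarith
qed

lemma near_top_heavy_blocks_exist:
  fixes X :: "tsirelson set"
  assumes X: "subspace X" and inf: "\<not> (\<exists>B. finite B \<and> X \<subseteq> span B)"
  obtains t y F x where "block_sequence t y" "\<And>i. supp (y i) \<subseteq> {(i + 1)\<^sup>2..}"
    "\<And>i. top_heavy (Suc i) ((1/2) ^ i) (y i) (F i)"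
    "range x \<subseteq> X" "\<And>i. norm (x i) = 1" "\<And>i. norm (x i - to_completion (y i)) \<le> (1/2) ^ (i + 2)"
proof -
  obtain V where V: "deep V"
    and near: "\<And>d. 0 < d \<Longrightarrow> \<exists>n. \<forall>z\<in>V. supp z \<subseteq> {n..} \<longrightarrow> (\<exists>v\<in>X. norm (v - to_completion z) \<le> d * norm z)"
    by (rule deep_subspace_exists[OF X inf]) (rule that)
  define Q where "Q i n y \<longleftrightarrow> norm y = 1 \<and> supp y \<subseteq> {(i + 1)\<^sup>2..} \<and>
      (\<exists>F. top_heavy (Suc i) ((1/2) ^ i) y F) \<and>
      (\<exists>x\<in>X. norm x = 1 \<and> norm (x - to_completion y) \<le> (1/2) ^ (i + 2))" for i n :: nat and y
  have ex: "\<exists>y. Q i n y \<and> supp y \<subseteq> {n..}" for i n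
  proof -
    \<comment> \<open>Half the error that is allowed, since normalization doubles it.\<close>
    define d where "d = (1/2::real) ^ (i + 3)"
    have dd: "2 * d = (1/2) ^ (i + 2)"
      by (simp add: d_def numeral_eq_Suc)
    have d: "0 < d" "d < 1" by (auto simp: d_def power_less_one_iff)
    obtain N where N: "\<And>z. z \<in> V \<Longrightarrow> supp z \<subseteq> {N..} \<Longrightarrow> \<exists>v\<in>X. norm (v - to_completion z) \<le> d * norm z"
      using near[OF d(1)] by blast
    obtain y F where y: "y \<in> V" "norm y = 1" "supp y \<subseteq> {max (max n N) ((i + 1)\<^sup>2)..}"
      and F: "top_heavy (Suc i) ((1/2) ^ i) y F"
      by (rule top_heavy_vector_exists[OF V, of "(1/2) ^ i" "Suc i" "max (max n N) ((i + 1)\<^sup>2)"])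
        (simp, simp, rule that)
    have "supp y \<subseteq> {N..}" using y(3) by auto
    then obtain v where v: "v \<in> X" "norm (v - to_completion y) \<le> d"
      using N[OF y(1)] y(2) by auto
    have vn: "v \<noteq> 0" "norm ((1 / norm v) *\<^sub>R v - to_completion y) \<le> 2 * d"
      using y(2) by (auto intro!: normalize_near_unit[OF _ v(2) d(2)])
    have "(1 / norm v) *\<^sub>R v \<in> X"
      using X v(1) by (rule subspace_scale)
    moreover have "norm ((1 / norm v) *\<^sub>R v) = 1" using vn by simp
    ultimately have "\<exists>x\<in>X. norm x = 1 \<and> norm (x - to_completion y) \<le> (1/2) ^ (i + 2)"
      using vn(2) unfolding dd by blast
    moreover note F
    moreover have "supp y \<subseteq> {(i + 1)\<^sup>2..}" "supp y \<subseteq> {n..}" using y(3) by auto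
    ultimately show ?thesis
      using y(2) unfolding Q_def by blast
  qed
  obtain t y where t: "strict_mono t" "t 0 = 0" and Q: "\<And>i. Q i (t i) (y i)"
    and sy: "\<And>i. supp (y i) \<subseteq> {t i..<t (Suc i)}"
    by (rule block_selection[where Q = Q and n = 0, OF ex]) (rule that)
  have "\<forall>i. \<exists>F x. top_heavy (Suc i) ((1/2) ^ i) (y i) F \<and>
      x \<in> X \<and> norm x = 1 \<and> norm (x - to_completion (y i)) \<le> (1/2) ^ (i + 2)"
    using Q unfolding Q_def by blast
  then obtain F x where F: "\<And>i. top_heavy (Suc i) ((1/2) ^ i) (y i) (F i)"
    and x: "\<And>i. x i \<in> X" "\<And>i. norm (x i) = 1" "\<And>i. norm (x i - to_completion (y i)) \<le> (1/2) ^ (i + 2)"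
    by metis
  show thesis
  proof (rule that)
    show "block_sequence t y"
      using t Q sy by (simp add: block_sequence_def Q_def)
    show "supp (y i) \<subseteq> {(i + 1)\<^sup>2..}" for i
      using Q[of i] by (simp add: Q_def)
  qed (use F x in auto)
qed

text \<open>
  The upper \<open>\<ell>\<^sub>1\<close>-estimate is the triangle inequality. The deficit in the lower one is at most
  \<open>3 \<cdot> 2\<^sup>-\<^sup>n\<close> times the sum of the moduli of the coefficients for the blocks, and another \<open>2\<^sup>-\<^sup>n\<close> for their
  perturbation.
\<close>

lemma spreading_model_of_top_heavy_blocks:
  assumes y: "block_sequence t y" and start: "\<And>i. supp (y i) \<subseteq> {(i + 1)\<^sup>2..}"
    and F: "\<And>i. top_heavy (Suc i) ((1/2) ^ i) (y i) (F i)"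
    and x: "\<And>i. norm (x i) = 1" "\<And>i. norm (x i - to_completion (y i)) \<le> (1/2) ^ (i + 2)"
    and s: "isometric_to_ell1_basis s"
  shows "spreading_model x s"
  unfolding spreading_model_def
proof (intro conjI exI allI impI)
  define e where "e n = 4 * (real n + 1) * (1/2) ^ n" for n
  show "normalized x" using x(1) by (simp add: normalized_def)
  show "basic_sequence x" using basic_perturbed_blocks[OF y x] .
  show "basic_sequence s" using s by (rule basic_sequence_of_isometric_ell1)
  show "decseq e"
    by (rule decseq_SucI) (simp add: e_def field_simps)
  show "e \<longlonglongrightarrow> 0"
    unfolding e_def by real_asymp
  fix n :: nat and a :: "nat \<Rightarrow> real" and k :: "nat \<Rightarrow> nat"
  assume a: "\<forall>i<n. a i \<in> {-1..1}" and k: "strict_mono_on {..<n} k" and n: "n \<le> Suc (k 0)"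
  let ?h = "(1/2::real) ^ n" and ?S = "\<Sum>i<n. \<bar>a i\<bar>"
  have upper: "norm (\<Sum>i<n. a i *\<^sub>R x (k i)) \<le> ?S"
    by (rule order_trans[OF norm_sum]) (simp add: x(1))
  have small: "(1/2::real) ^ (k i + 2) \<le> ?h" if "i < n" for i
  proof -
    have "k 0 \<le> k i"
      using k that by (cases "i = 0") (auto simp: strict_mono_on_def intro: less_imp_le)
    then show ?thesis using n by (intro power_decreasing) auto
  qed
  have "norm ((\<Sum>i<n. a i *\<^sub>R x (k i)) - to_completion (\<Sum>i<n. a i *\<^sub>R y (k i))) \<le> (\<Sum>i<n. \<bar>a i\<bar> * ?h)"
    by (rule norm_perturbed_sum_le) (use order_trans[OF x(2) small] in simp)
  then have "norm (to_completion (\<Sum>i<n. a i *\<^sub>R y (k i))) - ?S * ?h \<le> norm (\<Sum>i<n. a i *\<^sub>R x (k i))"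
    using norm_triangle_sub[of "to_completion (\<Sum>i<n. a i *\<^sub>R y (k i))" "\<Sum>i<n. a i *\<^sub>R x (k i)"]
    by (simp add: norm_minus_commute sum_distrib_right)
  moreover have "(1 - 3 * ?h) * ?S \<le> norm (\<Sum>i<n. a i *\<^sub>R y (k i))"
    by (rule top_heavy_blocks_sum_ge[OF y start F k n])
  ultimately have lower: "?S - 4 * (?S * ?h) \<le> norm (\<Sum>i<n. a i *\<^sub>R x (k i))"
    by (simp add: algebra_simps)
  have "?S \<le> (\<Sum>i<n. 1)"
    using a by (intro sum_mono) auto
  then have "?S * ?h \<le> real n * ?h"
    by (intro mult_right_mono) auto
  moreover have "e n = 4 * (real n * ?h) + 4 * ?h"
    by (simp add: e_def algebra_simps)
  moreover have "0 < ?h"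
    by simp
  ultimately have "4 * (?S * ?h) < e n"
    by linarith
  moreover have "norm (\<Sum>i<n. a i *\<^sub>R s i) = ?S"
    using s by (simp add: isometric_to_ell1_basis_def)
  ultimately show "\<bar>norm (\<Sum>i<n. a i *\<^sub>R x (k i)) - norm (\<Sum>i<n. a i *\<^sub>R s i)\<bar> < e n"
    using upper lower by linarith
qed

theorem theoremB:
  fixes X :: "tsirelson set"
  assumes "subspace X" and "closed X"
    and infinite_dim: "\<not> (\<exists>B. finite B \<and> X \<subseteq> span B)"
  shows "\<exists>(x :: nat \<Rightarrow> tsirelson) (s :: nat \<Rightarrow> ell_infinity).
    range x \<subseteq> X \<and> spreading_model x s \<and> isometric_to_ell1_basis s"
proof -
  obtain t y F x where blocks: "block_sequence t y" "\<And>i. supp (y i) \<subseteq> {(i + 1)\<^sup>2..}"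
    "\<And>i. top_heavy (Suc i) ((1/2) ^ i) (y i) (F i)"
    and X: "range x \<subseteq> X"
    and x: "\<And>i. norm (x i) = 1" "\<And>i. norm (x i - to_completion (y i)) \<le> (1/2) ^ (i + 2)"
    by (rule near_top_heavy_blocks_exist[OF assms(1) infinite_dim]) (rule that)
  have "spreading_model x rademacher"
    by (rule spreading_model_of_top_heavy_blocks[OF blocks x isometric_rademacher])
  then show ?thesis
    using X isometric_rademacher by blast
qed

end
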